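(* Let $\mathcal N=\mathbb N^{\mathbb N}$, let $2=\{0,1\}$ be the discrete two-point space, and let $\mathcal C(\mathcal N,2)$ be the represented space of continuous functions from $\mathcal N$ to $2$ (clopen subsets of $\mathcal N$). The space $\mathcal C(\mathcal N,2)$ is not $\mathcal N$-based. Its computable open sets are not $\Sigma^1_1$-enumerable and are not enumerable relative to any $\Delta^1_1$ oracle.
   Context: A represented space is a pair $\mathbf X=(X,\delta_X)$ with $\delta_X:\subseteq\mathcal N\to X$ a partial surjective map; $p$ is a name of $x$ if $\delta_X(p)=x$; $x$ is computable if it has a computable name. A function $f:\mathbf X\to\mathbf Y$ is continuous (resp. computable, computable relative to an oracle $A$) if there is a continuous (resp. computable, $A$-computable) realizer $F:\mathrm{dom}(\delta_X)\to\mathrm{dom}(\delta_Y)$ with $\delta_Y(F(p))=f(\delta_X(p))$ for all $p$. The topology of $\mathbf X$ is the final topology of $\delta_X$. $\mathbb N$ and $2$ are represented by $p\mapsto p(0)$ (with $p(0)\in\{0,1\}$ for $2$), $\mathcal N$ by the identity; subsets carry the restricted representation. $\mathcal C(\mathbf X,\mathbf Y)$ is the represented space of continuous functions, a name of $f$ being a standard effective encoding in $\mathcal N$ of any continuous realizer of $f$. The Sierpiński space is $\mathbb S=\{\bot,\top\}$ with $\delta_{\mathbb S}(0^{\mathbb N})=\bot$, $\delta_{\mathbb S}(p)=\top$ for $p\ne0^{\mathbb N}$. $\mathcal O(\mathbf X)=\mathcal C(\mathbf X,\mathbb S)$ is the represented space of open subsets; a computable open subset of $\mathbf X$ is a computable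 point of $\mathcal O(\mathbf X)$. $\mathbf X$ is $\mathcal N$-based if there is a continuous function $\mathcal N\to\mathcal O(\mathbf X)$ whose image is a basis of the topology of $\mathbf X$ (equivalently, $\mathcal O(\mathbf X)$ is a continuous image of $\mathcal N$). The computable open subsets of $\mathbf X$ are $\Sigma^1_1$-enumerable if the set of them is the image of some lightface $\Sigma^1_1$ set $S\subseteq\mathbb N$ under a computable function $S\to\mathcal O(\mathbf X)$. They are enumerable relative to an oracle $A\subseteq\mathbb N$ if there is a function $\mathbb N\to\mathcal O(\mathbf X)$, computable relative to $A$, whose range contains all of them; a $\Delta^1_1$ oracle is a lightface $\Delta^1_1$ subset of $\mathbb N$. *)

theory Defs
  imports "HOL-Analysis.Analysis" "HOL-Library.Nat_Bijection" "HOL-Library.FuncSet"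
begin

text \<open>The topology on \<open>nat \<Rightarrow> nat\<close> is the library's product topology of the discrete space.\<close>

type_synonym baire = "nat \<Rightarrow> nat"

text \<open>Kleene's partial recursive functions of several arguments, with one additional initial
  function \<open>Query\<close>, which asks the function \<open>p\<close> given as an oracle.  An argument tuple is a list;
  where no rule applies, the function is undefined.\<close>

datatype recf =
    Zero
  | Succ
  | Proj nat
  | Query
  | Comp recf "recf list"
  | PrimRec recf recf
  | Mu recf

inductive recf_eval :: "baire \<Rightarrow> recf \<Rightarrow> nat list \<Rightarrow> nat \<Rightarrow> bool" for p :: baire where
  Zero: "recf_eval p Zero xs 0"
| Succ: "recf_eval p Succ [x] (Suc x)"
| Proj: "i < length xs \<Longrightarrow> recf_eval p (Proj i) xs (xs ! i)"
| Query: "recf_eval p Query [x] (p x)"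
| Comp: "list_all2 (\<lambda>g y. recf_eval p g xs y) gs ys \<Longrightarrow> recf_eval p f ys z \<Longrightarrow>
    recf_eval p (Comp f gs) xs z"
| PrimRec_0: "recf_eval p f xs y \<Longrightarrow> recf_eval p (PrimRec f g) (0 # xs) y"
| PrimRec_Suc: "recf_eval p (PrimRec f g) (n # xs) y \<Longrightarrow> recf_eval p g (n # y # xs) z \<Longrightarrow>
    recf_eval p (PrimRec f g) (Suc n # xs) z"
| Mu: "recf_eval p f (n # xs) 0 \<Longrightarrow> \<forall>m<n. \<exists>y. recf_eval p f (m # xs) (Suc y) \<Longrightarrow>
    recf_eval p (Mu f) xs n"

inductive_cases recf_evalE:
  "recf_eval p Zero xs z" "recf_eval p Succ xs z" "recf_eval p (Proj i) xs z"
  "recf_eval p Query xs z" "recf_eval p (Comp f gs) xs z" "recf_eval p (PrimRec f g) (0 # xs) z"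
  "recf_eval p (PrimRec f g) (Suc n # xs) z" "recf_eval p (Mu f) xs z"

lemma recf_eval_functional: "recf_eval p f xs y \<Longrightarrow> recf_eval p f xs z \<Longrightarrow> y = z"
proof (induction arbitrary: z rule: recf_eval.induct)
  case (Zero xs)
  then show ?case by (rule recf_evalE(1)) simp
next
  case (Succ x)
  then show ?case by (rule recf_evalE(2)) simp
next
  case (Proj i xs)
  from Proj.prems show ?case by (rule recf_evalE(3)) simp
next
  case (Query x)
  then show ?case by (rule recf_evalE(4)) simp
next
  case (Comp xs gs ys f y)
  from Comp.prems obtain ys' where
    ys': "list_all2 (\<lambda>g y. recf_eval p g xs y) gs ys'" "recf_eval p f ys' z"
    by (rule recf_evalE(5))
  have "ys = ys'"
    using Comp.IH(1) ys'(1) by (auto simp: list_all2_conv_all_nth intro!: nth_equalityI)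
  then show ?case using Comp.IH(2) ys'(2) by blast
next
  case (PrimRec_0 f xs y g)
  from PrimRec_0.prems show ?case by (rule recf_evalE(6)) (rule PrimRec_0.IH)
next
  case (PrimRec_Suc f g n xs y w)
  from PrimRec_Suc.prems obtain y' where
    "recf_eval p (PrimRec f g) (n # xs) y'" "recf_eval p g (n # y' # xs) z"
    by (rule recf_evalE(7))
  then show ?case using PrimRec_Suc.IH by blast
next
  case (Mu f n xs)
  from Mu.prems have "recf_eval p f (z # xs) 0 \<and>
      (\<forall>m<z. \<exists>y. recf_eval p f (m # xs) (Suc y))"
    by (rule recf_evalE(8)) simp
  then have z: "recf_eval p f (z # xs) 0" "\<forall>m<z. \<exists>y. recf_eval p f (m # xs) (Suc y)"
    by blast+
  show ?case
  proof (rule linorder_cases[of n z])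
    assume "n < z"
    then obtain y where "recf_eval p f (n # xs) (Suc y)" using z(2) by blast
    then show ?thesis using Mu.IH(1) by blast
  next
    assume "z < n"
    then show ?thesis using Mu.IH(2) z(1) by blast
  qed
qed

definition computable_point :: "baire \<Rightarrow> bool" where
  "computable_point p \<longleftrightarrow> (\<exists>e. \<forall>n. recf_eval (\<lambda>_. 0) e [n] (p n))"

definition computable_on :: "baire set \<Rightarrow> (baire \<Rightarrow> baire) \<Rightarrow> bool" where
  "computable_on D F \<longleftrightarrow> (\<exists>e. \<forall>p\<in>D. \<forall>n. recf_eval p e [n] (F p n))"

definition join :: "baire \<Rightarrow> baire \<Rightarrow> baire" where
  "join a p n = (if even n then a (n div 2) else p (n div 2))"

definition computable_on_rel :: "nat set \<Rightarrow> baire set \<Rightarrow> (baire \<Rightarrow> baire) \<Rightarrow> bool" where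
  "computable_on_rel A D F \<longleftrightarrow>
    (\<exists>e. \<forall>p\<in>D. \<forall>n. recf_eval (join (\<lambda>k. of_bool (k \<in> A)) p) e [n] (F p n))"

text \<open>Lightface \<open>\<Sigma>\<^sup>1\<^sub>1\<close> sets are the projections along Baire space of lightface \<open>\<Pi>\<^sup>0\<^sub>1\<close> sets, which are
  the complements of the domains of partial recursive functionals.\<close>

definition Pi01 :: "(nat \<times> baire) set \<Rightarrow> bool" where
  "Pi01 P \<longleftrightarrow> (\<exists>e. P = {(n, x). \<not> (\<exists>y. recf_eval x e [n] y)})"

definition Sigma11 :: "nat set \<Rightarrow> bool" where
  "Sigma11 S \<longleftrightarrow> (\<exists>P. Pi01 P \<and> S = {n. \<exists>x. (n, x) \<in> P})"

definition Delta11 :: "nat set \<Rightarrow> bool" where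
  "Delta11 S \<longleftrightarrow> Sigma11 S \<and> Sigma11 (- S)"


text \<open>A represented space is given by its partial map \<open>X\<close>; since that map is surjective, the set of
  points of the space is \<open>ran X\<close>, and a function between represented spaces matters only there.\<close>

type_synonym 'a rep_space = "baire \<Rightarrow> 'a option"

definition computable_points :: "'a rep_space \<Rightarrow> 'a set" where
  "computable_points X = {x. \<exists>p. computable_point p \<and> X p = Some x}"

definition realizer :: "'a rep_space \<Rightarrow> 'b rep_space \<Rightarrow> (baire \<Rightarrow> baire) \<Rightarrow> ('a \<Rightarrow> 'b) \<Rightarrow> bool" where
  "realizer X Y F f \<longleftrightarrow> (\<forall>p x. X p = Some x \<longrightarrow> Y (F p) = Some (f x))"

definition continuous_rep :: "'a rep_space \<Rightarrow> 'b rep_space \<Rightarrow> ('a \<Rightarrow> 'b) \<Rightarrow> bool" where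
  "continuous_rep X Y f \<longleftrightarrow> (\<exists>F. continuous_on (dom X) F \<and> realizer X Y F f)"

definition computable_rep :: "'a rep_space \<Rightarrow> 'b rep_space \<Rightarrow> ('a \<Rightarrow> 'b) \<Rightarrow> bool" where
  "computable_rep X Y f \<longleftrightarrow> (\<exists>F. computable_on (dom X) F \<and> realizer X Y F f)"

definition computable_rep_rel :: "nat set \<Rightarrow> 'a rep_space \<Rightarrow> 'b rep_space \<Rightarrow> ('a \<Rightarrow> 'b) \<Rightarrow> bool" where
  "computable_rep_rel A X Y f \<longleftrightarrow> (\<exists>F. computable_on_rel A (dom X) F \<and> realizer X Y F f)"

definition rep_topology :: "'a rep_space \<Rightarrow> 'a topology" where
  "rep_topology X = topology (\<lambda>U. U \<subseteq> ran X \<and>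
    openin (top_of_set (dom X)) {p \<in> dom X. the (X p) \<in> U})"

lemma openin_rep_topology:
  "openin (rep_topology X) U \<longleftrightarrow>
    U \<subseteq> ran X \<and> openin (top_of_set (dom X)) {p \<in> dom X. the (X p) \<in> U}"
proof -
  let ?T = "top_of_set (dom X)" and ?pre = "\<lambda>U. {p \<in> dom X. the (X p) \<in> U}"
  have "openin ?T (?pre (U \<inter> V))" if "openin ?T (?pre U)" "openin ?T (?pre V)" for U V
  proof -
    have "?pre (U \<inter> V) = ?pre U \<inter> ?pre V" by blast
    then show ?thesis using openin_Int[OF that] by simp
  qed
  moreover have "openin ?T (?pre (\<Union>K))" if "\<forall>U\<in>K. openin ?T (?pre U)" for K
  proof -
    have "?pre (\<Union>K) = \<Union>(?pre ` K)" by blast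
    moreover have "openin ?T (\<Union>(?pre ` K))" by (rule openin_Union) (use that in blast)
    ultimately show ?thesis by simp
  qed
  ultimately have "istopology (\<lambda>U. U \<subseteq> ran X \<and> openin ?T (?pre U))"
    unfolding istopology_def by (simp add: Union_least le_infI1)
  then show ?thesis
    unfolding rep_topology_def by (simp add: topology_inverse')
qed

definition rep_baire :: "baire rep_space" where
  "rep_baire p = Some p"

definition rep_nat :: "nat rep_space" where
  "rep_nat p = Some (p 0)"

definition subspace_rep :: "'a rep_space \<Rightarrow> 'a set \<Rightarrow> 'a rep_space" where
  "subspace_rep X A p = (case X p of None \<Rightarrow> None | Some x \<Rightarrow> if x \<in> A then Some x else None)"

definition rep_two :: "nat rep_space" where
  "rep_two = subspace_rep rep_nat {0, 1}"

definition sierpinski :: "bool rep_space" where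
  "sierpinski p = Some (p \<noteq> (\<lambda>_. 0))"

text \<open>Continuous partial functions on Baire space are encoded by Kleene associates: the value
  \<open>F p n\<close> of the encoded function is found by feeding \<open>n\<close> and longer and longer prefixes of \<open>p\<close>
  to \<open>a\<close>, until the answer is nonzero; this answer is then \<open>F p n + 1\<close>.\<close>

definition query_code :: "nat \<Rightarrow> baire \<Rightarrow> nat \<Rightarrow> nat" where
  "query_code n p k = list_encode (n # map p [0..<k])"

definition associate_apply :: "baire \<Rightarrow> baire \<Rightarrow> baire option" where
  "associate_apply a p =
    (if \<forall>n. \<exists>k. a (query_code n p k) \<noteq> 0
     then Some (\<lambda>n. a (query_code n p (LEAST k. a (query_code n p k) \<noteq> 0)) - 1)
     else None)"

text \<open>\<open>a\<close> is a name of \<open>f\<close> iff it encodes a realizer of \<open>f\<close>.  Functions are taken in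
  \<open>extensional (ran X)\<close> so that their values outside the space \<open>X\<close> do not create further points.\<close>

definition fun_name :: "'a rep_space \<Rightarrow> 'b rep_space \<Rightarrow> baire \<Rightarrow> ('a \<Rightarrow> 'b) \<Rightarrow> bool" where
  "fun_name X Y a f \<longleftrightarrow> f \<in> extensional (ran X) \<and>
    (\<forall>p x. X p = Some x \<longrightarrow> (\<exists>q. associate_apply a p = Some q \<and> Y q = Some (f x)))"

definition fun_rep :: "'a rep_space \<Rightarrow> 'b rep_space \<Rightarrow> ('a \<Rightarrow> 'b) rep_space" where
  "fun_rep X Y a =
    (if \<exists>f. fun_name X Y a f then Some (THE f. fun_name X Y a f) else None)"

lemma fun_name_unique:
  assumes "fun_name X Y a f" "fun_name X Y a g"
  shows "f = g"
proof (rule extensionalityI[of _ "ran X"])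
  show "f \<in> extensional (ran X)" "g \<in> extensional (ran X)"
    using assms by (simp_all add: fun_name_def)
  fix x assume "x \<in> ran X"
  then obtain p where "X p = Some x" by (auto simp: ran_def)
  then have "Some (f x) = Some (g x)"
    using assms unfolding fun_name_def by (metis option.inject)
  then show "f x = g x" by simp
qed

lemma fun_rep_eq_Some_iff: "fun_rep X Y a = Some f \<longleftrightarrow> fun_name X Y a f"
proof -
  have "(THE f. fun_name X Y a f) = g" if "fun_name X Y a g" for g
    using that fun_name_unique by blast
  then show ?thesis by (auto simp: fun_rep_def)
qed

abbreviation opens_rep :: "'a rep_space \<Rightarrow> ('a \<Rightarrow> bool) rep_space" where
  "opens_rep X \<equiv> fun_rep X sierpinski"

definition set_of_open :: "'a rep_space \<Rightarrow> ('a \<Rightarrow> bool) \<Rightarrow> 'a set" where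
  "set_of_open X U = {x \<in> ran X. U x}"

definition topology_basis :: "'a topology \<Rightarrow> 'a set set \<Rightarrow> bool" where
  "topology_basis T B \<longleftrightarrow>
    (\<forall>V\<in>B. openin T V) \<and> (\<forall>U. openin T U \<longrightarrow> (\<exists>B'\<subseteq>B. \<Union>B' = U))"

definition baire_based :: "'a rep_space \<Rightarrow> bool" where
  "baire_based X \<longleftrightarrow> (\<exists>f. continuous_rep rep_baire (opens_rep X) f \<and>
    topology_basis (rep_topology X) (set_of_open X ` range f))"

definition computable_opens_Sigma11_enumerable :: "'a rep_space \<Rightarrow> bool" where
  "computable_opens_Sigma11_enumerable X \<longleftrightarrow>
    (\<exists>S f. Sigma11 S \<and> computable_rep (subspace_rep rep_nat S) (opens_rep X) f \<and>
      f ` S = computable_points (opens_rep X))"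

definition computable_opens_enumerable_rel :: "nat set \<Rightarrow> 'a rep_space \<Rightarrow> bool" where
  "computable_opens_enumerable_rel A X \<longleftrightarrow>
    (\<exists>f. computable_rep_rel A rep_nat (opens_rep X) f \<and>
      computable_points (opens_rep X) \<subseteq> range f)"

end

theory Submission
  imports Defs
begin

text \<open>
  All three claims say that some family of open sets of the space of clopen sets misses an open set,
  and all three follow from one diagonal construction (\<open>ex_diagonal_open\<close>): given open sets
  \<open>V p\<close>, where \<open>p\<close> ranges over a closed set \<open>D\<close> of Baire space and \<open>V p\<close> depends continuously
  on \<open>p\<close>, there is an open set \<open>U\<close> that contains the empty clopen set \<open>0\<close> (the zero function) such that
  no \<open>V p\<close> with \<open>0 \<in> V p\<close> is contained in \<open>U\<close>. Moreover, \<open>U\<close> is computable if \<open>D\<close> and \<open>V\<close> are effective.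

  The construction rests on a closed copy of Baire space among the clopen sets. A name of a
  clopen set must reveal, for every point \<open>y\<close>, a neighbourhood of \<open>y\<close> that is contained in the
  set or disjoint from it.
  For every finite sequence \<open>\<sigma>\<close>, let \<open>y\<^sub>\<sigma>\<close> be the point that consists of a code of \<open>\<sigma>\<close> followed by
  zeros. Let a clopen set contain none of these points but, for every \<open>i\<close> and \<open>\<sigma> = p(0)\<dots>p(i - 1)\<close>,
  a cylinder that branches off from \<open>y\<^sub>\<sigma>\<close> after exactly \<open>p(i)\<close> zeros (a \<open>spike\<close>).
  Then a name of that set gives a bound on \<open>p(0)\<close>, hence finitely many candidates for it, for each of
  them a bound on \<open>p(1)\<close>, and so on: a compact set of candidates \<open>p\<close>. Therefore it is
  semidecidable from a name of a clopen set \<open>g\<close> that \<open>g\<close> differs from the spiked sets of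
  all \<open>p \<in> D\<close>, although this is a condition on all elements of an uncountable set
  (\<open>refuted_sound\<close>, \<open>refuted_complete\<close>).

  The spikes carry one more parameter \<open>c\<close>, the coordinate at which they branch off. A
  large \<open>c\<close> hides the spike: there is a name of \<open>0\<close>, depending on \<open>p\<close>, whose first \<open>k\<close> entries are also
  correct for the set with spikes of parameter \<open>k + 1\<close>. If \<open>0 \<in> V p\<close>, then this is confirmed by
  the first \<open>k\<close> entries for some \<open>k\<close>; for this \<open>k\<close>, the spiked set \<open>test p\<close> is also in \<open>V p\<close>
  (\<open>test_accepted\<close>). The complement \<open>U\<close> of all \<open>test p\<close> is the required open set. To make the
  test sets a closed set again, \<open>k\<close> is the least number of this kind, hence a continuous function of \<open>p\<close>, and
  \<open>p\<close> is preceded by a stage at which \<open>0 \<in> V p\<close> is confirmed, so that \<open>k\<close> is defined on a closed set.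

  For the first claim, \<open>D\<close> is the whole of Baire space. For an enumeration over a \<open>\<Sigma>\<^sup>1\<^sub>1\<close> set \<open>S\<close>, let
  \<open>D\<close> consist of the elements of \<open>S\<close> together with witnesses of their membership. For an enumeration relative to
  a \<open>\<Delta>\<^sup>1\<^sub>1\<close> oracle \<open>A\<close>, let \<open>D\<close> consist of an index, the oracle itself, and for each number a
  witness that the oracle is right about it. In both cases \<open>D\<close> is a \<open>\<Pi>\<^sup>0\<^sub>1\<close> set, and the computable open set \<open>U\<close> cannot
  be listed: it would be some \<open>V p\<close>, contain \<open>0\<close>, and not be contained in itself.
\<close>

section \<open>Computability on coded types\<close>

text \<open>Functions on pairs and finite sequences are computed on codes. The class fixes a code for
  each type, so that the type of a function tells how its arguments are coded, and a proof of computability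
  follows the structure of the term.\<close>

class coded =
  fixes enc :: "'a \<Rightarrow> nat"

instantiation nat :: coded
begin
definition "enc (n :: nat) = n"
instance ..
end

instantiation bool :: coded
begin
definition "enc b = (of_bool b :: nat)"
instance ..
end

instantiation prod :: (coded, coded) coded
begin
definition "enc z = prod_encode (enc (fst z), enc (snd z))"
instance ..
end

instantiation list :: (coded) coded
begin
definition "enc xs = list_encode (map enc xs)"
instance ..
end

lemma enc_nat_list [simp]: "enc (xs :: nat list) = list_encode xs"
proof -
  have "(enc :: nat \<Rightarrow> nat) = id" by (simp add: fun_eq_iff enc_nat_def)
  then show ?thesis by (simp add: enc_list_def)
qed

abbreviation computes :: "recf \<Rightarrow> nat list \<Rightarrow> nat \<Rightarrow> bool" where
  "computes \<equiv> recf_eval (\<lambda>_. 0)"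

definition computable :: "('a :: coded \<Rightarrow> 'b :: coded) \<Rightarrow> bool" where
  "computable f \<longleftrightarrow> (\<exists>e. \<forall>x. computes e [enc x] (enc (f x)))"

text \<open>The rules with this attribute decompose terms. A rule for a binding operator such as
  \<^const>\<open>rec_nat\<close> or a bounded quantifier makes the bound variable the second component of the
  argument.\<close>

named_theorems computable_intros

lemma computable_cong_enc:
  assumes "computable f" "\<And>x. enc (f x) = enc (g x)"
  shows "computable g"
  using assms unfolding computable_def by simp

lemma computes_Comp1: "computes g xs y \<Longrightarrow> computes f [y] z \<Longrightarrow> computes (Comp f [g]) xs z"
  by (rule recf_eval.Comp[where ys = "[y]"]) auto

lemma computes_Comp2:
  "computes g xs y \<Longrightarrow> computes g' xs y' \<Longrightarrow> computes f [y, y'] z \<Longrightarrow> computes (Comp f [g, g']) xs z"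
  by (rule recf_eval.Comp[where ys = "[y, y']"]) auto

lemma computes_Proj: "i < length xs \<Longrightarrow> y = xs ! i \<Longrightarrow> computes (Proj i) xs y"
  by (simp add: recf_eval.Proj)

lemma computes_Succ: "y = Suc x \<Longrightarrow> computes Succ [x] y"
  by (simp add: recf_eval.Succ)

lemma computes_PrimRec:
  assumes "computes f xs (r 0)"
    and "\<And>i. computes g (i # r i # xs) (r (Suc i))"
  shows "computes (PrimRec f g) (n # xs) (r n)"
proof (induction n)
  case 0
  show ?case using assms(1) by (rule recf_eval.PrimRec_0)
next
  case (Suc n)
  show ?case using Suc assms(2) by (rule recf_eval.PrimRec_Suc)
qed

lemma computes_const: "\<exists>e. \<forall>xs. computes e xs c"
proof (induction c)
  case 0
  show ?case using recf_eval.Zero by blast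
next
  case (Suc c)
  then obtain e where e: "\<And>xs. computes e xs c" by blast
  have "computes (Comp Succ [e]) xs (Suc c)" for xs
    by (rule computes_Comp1[OF e]) (simp add: computes_Succ)
  then show ?case by blast
qed

definition "add_prog = PrimRec (Proj 0) (Comp Succ [Proj 1])"

lemma computes_add: "computes add_prog [a, b] (a + b)"
  unfolding add_prog_def
  by (rule computes_PrimRec[where r = "\<lambda>n. n + b"])
    (auto intro!: computes_Comp1[OF computes_Proj] computes_Proj computes_Succ)

definition "triangle_prog = PrimRec Zero (Comp add_prog [Comp Succ [Proj 0], Proj 1])"

lemma computes_triangle: "computes triangle_prog [a] (triangle a)"
  unfolding triangle_prog_def
proof (rule computes_PrimRec)
  show "computes Zero [] (triangle 0)" using recf_eval.Zero by simp
  show "computes (Comp add_prog [Comp Succ [Proj 0], Proj 1]) [i, triangle i] (triangle (Suc i))" for i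
    using computes_add[of "Suc i" "triangle i"]
    by (intro computes_Comp2[OF computes_Comp1[OF computes_Proj computes_Succ] computes_Proj])
      (auto simp: add.commute)
qed

definition "pair_prog = Comp add_prog [Comp triangle_prog [add_prog], Proj 0]"

lemma computes_pair: "computes pair_prog [a, b] (prod_encode (a, b))"
  unfolding pair_prog_def prod_encode_def
  by (rule computes_Comp2[OF computes_Comp1[OF computes_add computes_triangle] computes_Proj])
    (auto intro: computes_add)

definition "pred_prog = PrimRec Zero (Proj 0)"

lemma computes_pred: "computes pred_prog [a] (a - 1)"
  unfolding pred_prog_def
  by (rule computes_PrimRec) (auto intro: computes_Proj recf_eval.Zero)

definition "sub_prog = PrimRec (Proj 0) (Comp pred_prog [Proj 1])"

lemma computes_sub: "computes sub_prog [b, a] (a - b)"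
  unfolding sub_prog_def
  by (rule computes_PrimRec[where r = "\<lambda>n. a - n"])
    (use computes_pred[of "a - _"] in \<open>auto intro!: computes_Comp1[OF computes_Proj] computes_Proj\<close>)

text \<open>The sum of the two components of \<open>prod_decode z\<close> is the largest \<open>k\<close> with
  \<open>triangle k \<le> z\<close>; going from \<open>z\<close> to \<open>z + 1\<close>, it grows by one exactly if \<open>z + 1\<close> is a triangular
  number.\<close>

fun diagonal :: "nat \<Rightarrow> nat" where
  "diagonal 0 = 0"
| "diagonal (Suc z) = diagonal z + (1 - (triangle (Suc (diagonal z)) - Suc z))"

lemma triangle_diagonal: "triangle (diagonal z) \<le> z \<and> z < triangle (Suc (diagonal z))"
proof (induction z)
  case (Suc z)
  show ?case
  proof (cases "triangle (Suc (diagonal z)) \<le> Suc z")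
    case True
    then have "diagonal (Suc z) = Suc (diagonal z)" by simp
    then show ?thesis using Suc True by simp
  next
    case False
    then have "diagonal (Suc z) = diagonal z" by simp
    then show ?thesis using Suc False by simp
  qed
qed simp

lemma prod_decode_eq_diagonal:
  "prod_decode z = (z - triangle (diagonal z), diagonal z - (z - triangle (diagonal z)))"
proof -
  have "prod_encode (z - triangle (diagonal z), diagonal z - (z - triangle (diagonal z))) = z"
    using triangle_diagonal[of z] by (simp add: prod_encode_def)
  then show ?thesis by (metis prod_encode_inverse)
qed

lemma computes_diagonal: "\<exists>e. \<forall>z. computes e [z] (diagonal z)"
proof -
  obtain one where one: "\<And>xs. computes one xs 1" using computes_const by blast
  let ?step = "Comp add_prog [Proj 1, Comp sub_prog
    [Comp sub_prog [Comp Succ [Proj 0], Comp triangle_prog [Comp Succ [Proj 1]]], one]]"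
  have "computes ?step [z, diagonal z] (diagonal (Suc z))" for z
    unfolding diagonal.simps
    by (rule computes_Comp2[OF computes_Proj computes_Comp2[OF computes_Comp2[OF
        computes_Comp1[OF computes_Proj computes_Succ]
        computes_Comp1[OF computes_Comp1[OF computes_Proj computes_Succ] computes_triangle]
        computes_sub] one computes_sub] computes_add]) auto
  then show ?thesis
    using computes_PrimRec[of Zero "[]" diagonal ?step] recf_eval.Zero by auto
qed

lemma computes_prod_decode:
  "\<exists>e. \<forall>z. computes e [z] (fst (prod_decode z))" "\<exists>e. \<forall>z. computes e [z] (snd (prod_decode z))"
proof -
  obtain d where d: "\<And>z. computes d [z] (diagonal z)" using computes_diagonal by blast
  let ?e = "Comp sub_prog [Comp triangle_prog [d], Proj 0]"
  have e: "computes ?e [z] (z - triangle (diagonal z))" for z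
    by (rule computes_Comp2[OF computes_Comp1[OF d computes_triangle] computes_Proj computes_sub]) auto
  moreover have "computes (Comp sub_prog [?e, d]) [z]
      (diagonal z - (z - triangle (diagonal z)))" for z
    by (rule computes_Comp2[OF e d computes_sub])
  ultimately show "\<exists>e. \<forall>z. computes e [z] (fst (prod_decode z))"
      "\<exists>e. \<forall>z. computes e [z] (snd (prod_decode z))"
    unfolding prod_decode_eq_diagonal by auto
qed

lemma computable_id [computable_intros]: "computable (\<lambda>x. x)"
  unfolding computable_def by (intro exI allI) (rule computes_Proj[of 0], auto)

lemma computable_const [computable_intros]: "computable (\<lambda>_. c)"
  unfolding computable_def using computes_const[of "enc c"] by auto

lemma computable_comp: "computable g \<Longrightarrow> computable f \<Longrightarrow> computable (\<lambda>x. g (f x))"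
  unfolding computable_def using computes_Comp1 by blast

lemma computable_Pair [computable_intros]:
  "computable f \<Longrightarrow> computable g \<Longrightarrow> computable (\<lambda>x. (f x, g x))"
  unfolding computable_def enc_prod_def fst_conv snd_conv
  using computes_Comp2[OF _ _ computes_pair] by blast

lemma computable_comp2:
  assumes "computable (\<lambda>z. h (fst z) (snd z))" "computable f" "computable g"
  shows "computable (\<lambda>x. h (f x) (g x))"
  using computable_comp[OF assms(1) computable_Pair[OF assms(2,3)]] by simp

lemma computable_comp3:
  assumes "computable (\<lambda>z. h (fst z) (fst (snd z)) (snd (snd z)))"
    "computable f" "computable g" "computable k"
  shows "computable (\<lambda>x. h (f x) (g x) (k x))"
  using computable_comp[OF assms(1) computable_Pair[OF assms(2) computable_Pair[OF assms(3,4)]]]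
  by simp

lemma computable_fst [computable_intros]: "computable f \<Longrightarrow> computable (\<lambda>x. fst (f x))"
  and computable_snd [computable_intros]: "computable f \<Longrightarrow> computable (\<lambda>x. snd (f x))"
proof -
  have "computable (fst :: 'b \<times> 'c \<Rightarrow> 'b)" "computable (snd :: 'b \<times> 'c \<Rightarrow> 'c)"
    using computes_prod_decode by (auto simp: computable_def enc_prod_def) (metis fst_conv snd_conv prod_encode_inverse)+
  then show "computable f \<Longrightarrow> computable (\<lambda>x. fst (f x))" "computable f \<Longrightarrow> computable (\<lambda>x. snd (f x))"
    by (blast intro: computable_comp)+
qed

lemma computable_rec_nat [computable_intros]:
  assumes b: "computable b" and s: "computable (\<lambda>z. s (fst z) (fst (snd z)) (snd (snd z)))"
    and n: "computable n"
  shows "computable (\<lambda>x. rec_nat (b x) (s x) (n x))"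
proof -
  obtain eb en es where e: "\<And>x. computes eb [enc x] (enc (b x))" "\<And>x. computes en [enc x] (enc (n x))"
    "\<And>x i a. computes es [prod_encode (enc x, prod_encode (i, enc a))] (enc (s x i a))"
    using b s n unfolding computable_def enc_prod_def
    by (metis enc_nat_def fst_conv snd_conv)
  let ?es = "Comp es [Comp pair_prog [Proj 2, Comp pair_prog [Proj 0, Proj 1]]]"
  have es: "computes ?es (i # enc a # [enc x]) (enc (s x i a))" for i a x
    by (rule computes_Comp1[OF computes_Comp2[OF computes_Proj computes_Comp2[OF computes_Proj
        computes_Proj computes_pair] computes_pair] e(3)]) auto
  have rec: "computes (PrimRec eb ?es) (m # [enc x]) (enc (rec_nat (b x) (s x) m))" for m x
    by (rule computes_PrimRec) (use e(1) es in auto)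
  have "computes (Comp (PrimRec eb ?es) [en, Proj 0]) [enc x] (enc (rec_nat (b x) (s x) (n x)))" for x
    by (rule computes_Comp2[OF e(2) computes_Proj]) (use rec in \<open>auto simp: enc_nat_def\<close>)
  then show ?thesis unfolding computable_def by blast
qed

lemma computable_of_bool [computable_intros]:
  "computable c \<Longrightarrow> computable (\<lambda>x. of_bool (c x) :: nat)"
  by (erule computable_cong_enc) (simp add: enc_bool_def enc_nat_def)

lemma computable_If [computable_intros]:
  assumes "computable c" "computable f" "computable g"
  shows "computable (\<lambda>x. if c x then f x else g x)"
proof -
  have "computable (\<lambda>x. rec_nat (g x) (\<lambda>_ _. f x) (of_bool (c x)))"
    by (intro computable_intros computable_comp[OF assms(2) computable_fst] assms)
  then show ?thesis by (rule computable_cong_enc) simp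
qed

lemma computable_Not [computable_intros]: "computable c \<Longrightarrow> computable (\<lambda>x. \<not> c x)"
  using computable_If[of c "\<lambda>_. False" "\<lambda>_. True"] by (simp add: computable_const if_bool_eq_conj cong: if_cong)

lemma computable_conj [computable_intros]:
  assumes "computable c" "computable d" shows "computable (\<lambda>x. c x \<and> d x)"
  by (rule computable_cong_enc[OF computable_If[OF assms computable_const[of False]]]) simp

lemma computable_disj [computable_intros]:
  assumes "computable c" "computable d" shows "computable (\<lambda>x. c x \<or> d x)"
  by (rule computable_cong_enc[OF computable_If[OF assms(1) computable_const[of True] assms(2)]]) simp

lemma computable_imp [computable_intros]:
  assumes "computable c" "computable d" shows "computable (\<lambda>x. c x \<longrightarrow> d x)"
  by (rule computable_cong_enc[OF computable_If[OF assms computable_const[of True]]]) simp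

lemma computable_Suc [computable_intros]: "computable f \<Longrightarrow> computable (\<lambda>x. Suc (f x))"
  unfolding computable_def enc_nat_def using computes_Comp1[OF _ recf_eval.Succ] by blast

lemma computable_diff [computable_intros]:
  fixes f g :: "_ \<Rightarrow> nat"
  shows "computable f \<Longrightarrow> computable g \<Longrightarrow> computable (\<lambda>x. f x - g x)"
  unfolding computable_def enc_nat_def using computes_Comp2[OF _ _ computes_sub] by blast

lemma computable_add [computable_intros]:
  fixes f g :: "_ \<Rightarrow> nat"
  shows "computable f \<Longrightarrow> computable g \<Longrightarrow> computable (\<lambda>x. f x + g x)"
  unfolding computable_def enc_nat_def using computes_Comp2[OF _ _ computes_add] by blast

lemma computable_eq_0: assumes "computable f" shows "computable (\<lambda>x. f x = (0 :: nat))"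
proof -
  have "computable (\<lambda>x. rec_nat True (\<lambda>_ _. False) (f x))"
    by (intro computable_intros assms)
  moreover have "rec_nat True (\<lambda>_ _. False) n = (n = 0)" for n by (cases n) auto
  ultimately show ?thesis by simp
qed

lemma computable_le [computable_intros]:
  fixes f g :: "_ \<Rightarrow> nat"
  assumes "computable f" "computable g" shows "computable (\<lambda>x. f x \<le> g x)"
  using computable_eq_0[OF computable_diff[OF assms]] by simp

lemma computable_less [computable_intros]:
  fixes f g :: "_ \<Rightarrow> nat"
  assumes "computable f" "computable g" shows "computable (\<lambda>x. f x < g x)"
  using computable_le[OF computable_Suc[OF assms(1)] assms(2)] by (simp add: Suc_le_eq)

lemma computable_eq_nat [computable_intros]:
  fixes f g :: "_ \<Rightarrow> nat"
  assumes "computable f" "computable g" shows "computable (\<lambda>x. f x = g x)"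
  using computable_conj[OF computable_le[OF assms] computable_le[OF assms(2,1)]]
  by (simp add: order_eq_iff)

lemma computable_prod_encode [computable_intros]:
  "computable f \<Longrightarrow> computable g \<Longrightarrow> computable (\<lambda>x. prod_encode (f x, g x))"
  by (rule computable_cong_enc[OF computable_Pair[of f g]]) (auto simp: enc_prod_def enc_nat_def)

lemma computable_prod_decode [computable_intros]:
  "computable f \<Longrightarrow> computable (\<lambda>x. prod_decode (f x))"
  by (erule computable_cong_enc) (simp add: enc_prod_def enc_nat_def)

lemma computable_list_encode [computable_intros]:
  "computable f \<Longrightarrow> computable (\<lambda>x. list_encode (f x))"
  by (erule computable_cong_enc) (simp add: enc_nat_def)

lemma computable_list_decode [computable_intros]:
  "computable f \<Longrightarrow> computable (\<lambda>x. list_decode (f x))"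
  by (erule computable_cong_enc) (simp add: enc_nat_def)

lemma computable_eq_list [computable_intros]:
  fixes f g :: "_ \<Rightarrow> nat list"
  assumes "computable f" "computable g" shows "computable (\<lambda>x. f x = g x)"
  using computable_eq_nat[OF assms[THEN computable_list_encode]] by (simp add: list_encode_eq)

lemma computable_Cons [computable_intros]:
  assumes "computable f" "computable g" shows "computable (\<lambda>x. (f x :: nat) # g x)"
  by (rule computable_cong_enc[OF computable_Suc[OF computable_prod_encode[OF assms(1)
      computable_list_encode[OF assms(2)]]]]) (simp add: enc_nat_def)

lemma computable_tl [computable_intros]:
  assumes "computable f" shows "computable (\<lambda>x. tl (f x :: nat list))"
proof -
  have "computable (\<lambda>c. if c = 0 then 0 else snd (prod_decode (c - 1)))"
    by (intro computable_intros)
  then have "computable (\<lambda>x. (\<lambda>c. if c = 0 then 0 else snd (prod_decode (c - 1))) (list_encode (f x)))"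
    by (rule computable_comp) (intro computable_intros assms)
  moreover have "(\<lambda>c. if c = 0 then 0 else snd (prod_decode (c - 1))) (list_encode xs) =
      list_encode (tl xs)" for xs
    by (cases xs) auto
  ultimately show ?thesis by (elim computable_cong_enc) (simp add: enc_nat_def)
qed

text \<open>A finite sequence is prolonged by zeros to a point of Baire space; every function on Baire
  space that only depends on a prefix of its argument is thereby a function on finite sequences.\<close>

definition ext :: "nat list \<Rightarrow> baire" where
  "ext xs i = (if i < length xs then xs ! i else 0)"

definition pre :: "baire \<Rightarrow> nat \<Rightarrow> nat list" where
  "pre p n = map p [0..<n]"

lemma length_pre [simp]: "length (pre p n) = n"
  by (simp add: pre_def)

lemma nth_pre [simp]: "i < n \<Longrightarrow> pre p n ! i = p i"
  by (simp add: pre_def)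

lemma ext_pre [simp]: "i < n \<Longrightarrow> ext (pre p n) i = p i"
  by (simp add: ext_def)

lemma pre_cong: "(\<And>i. i < n \<Longrightarrow> p i = q i) \<Longrightarrow> pre p n = pre q n"
  by (simp add: pre_def)

lemma ext_Cons: "ext (x # xs) i = (case i of 0 \<Rightarrow> x | Suc j \<Rightarrow> ext xs j)"
  by (simp add: ext_def split: nat.split)

lemma length_le_list_encode: "length xs \<le> list_encode xs"
proof (induction xs)
  case (Cons x xs)
  then show ?case using le_prod_encode_2[of "list_encode xs" x] by simp
qed simp

lemma less_list_encode: "x \<in> set xs \<Longrightarrow> x < list_encode xs"
proof (induction xs)
  case (Cons y ys)
  then show ?case
    using le_prod_encode_2[of "list_encode ys" y] le_prod_encode_1[of y "list_encode ys"] by auto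
qed simp

lemma computable_drop:
  assumes "computable f" "computable n" shows "computable (\<lambda>x. drop (n x) (f x :: nat list))"
proof -
  have "rec_nat xs (\<lambda>_. tl) k = drop k xs" for xs :: "nat list" and k
    by (induction k) (simp_all add: drop_Suc tl_drop)
  moreover have "computable (\<lambda>x. rec_nat (f x) (\<lambda>_. tl) (n x))"
    by (intro computable_intros assms)
  ultimately show ?thesis by simp
qed

lemma computable_ext [computable_intros]:
  assumes "computable f" "computable n" shows "computable (\<lambda>x. ext (f x) (n x))"
proof -
  have "computable (\<lambda>x. fst (prod_decode (list_encode (drop (n x) (f x)) - 1)))"
    by (intro computable_intros computable_drop assms)
  moreover have "fst (prod_decode (list_encode (drop k xs) - 1)) = ext xs k" for xs k
  proof (cases "k < length xs")
    case True
    then show ?thesis by (simp add: Cons_nth_drop_Suc[symmetric] ext_def)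
  next
    case False
    have "prod_decode 0 = (0, 0)" by (simp add: prod_decode_def prod_decode_aux.simps)
    then show ?thesis using False by (simp add: ext_def)
  qed
  ultimately show ?thesis by simp
qed

lemma computable_length [computable_intros]:
  assumes "computable f" shows "computable (\<lambda>x. length (f x :: nat list))"
proof -
  have rec: "rec_nat 0 (\<lambda>i a. if drop i xs = [] then a else Suc i) k = min k (length xs)"
    for xs :: "nat list" and k by (induction k) auto
  have "computable (\<lambda>x. rec_nat 0 (\<lambda>i a. if drop i (f x) = [] then a else Suc i) (list_encode (f x)))"
    by (intro computable_intros computable_drop computable_comp[OF assms computable_fst] assms)
  then show ?thesis unfolding rec using length_le_list_encode by (simp add: min_absorb2)
qed

lemma computable_pre [computable_intros]:
  assumes "computable (\<lambda>z. p (fst z) (snd z))" "computable n"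
  shows "computable (\<lambda>x. pre (p x) (n x))"
proof -
  \<comment> \<open>The list is built from its end, as cons is the basic operation.\<close>
  let ?rec = "\<lambda>q m. rec_nat [] (\<lambda>i r. q (m - Suc i) # r)"
  have rec: "k \<le> m \<Longrightarrow> ?rec q m k = map q [m - k..<m]" for q k and m :: nat
  proof (induction k)
    case (Suc k)
    then have "[m - Suc k..<m] = (m - Suc k) # [m - k..<m]"
      by (subst upt_rec) (auto simp: Suc_diff_Suc)
    then show ?case using Suc by simp
  qed simp
  have "?rec q m m = pre q m" for q m using rec[of m m q] by (simp add: pre_def)
  moreover have "computable (\<lambda>x. ?rec (p x) (n x) (n x))"
    by (intro computable_intros computable_comp2[OF assms(1)] computable_comp[OF assms(2) computable_fst] assms(2))
  ultimately show ?thesis by simp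
qed

lemma computable_bounded_ex [computable_intros]:
  fixes n :: "_ \<Rightarrow> nat"
  assumes "computable (\<lambda>z. P (fst z) (snd z))" "computable n"
  shows "computable (\<lambda>x. \<exists>i<n x. P x i)"
proof -
  have "rec_nat False (\<lambda>i a. a \<or> Q i) k = (\<exists>i<k. Q i)" for Q k
    by (induction k) (auto simp: less_Suc_eq)
  moreover have "computable (\<lambda>x. rec_nat False (\<lambda>i a. a \<or> P x i) (n x))"
    by (intro computable_intros computable_comp2[OF assms(1)] assms(2))
  ultimately show ?thesis by simp
qed

lemma computable_bounded_all [computable_intros]:
  fixes n :: "_ \<Rightarrow> nat"
  assumes "computable (\<lambda>z. P (fst z) (snd z))" "computable n"
  shows "computable (\<lambda>x. \<forall>i<n x. P x i)"
  using computable_Not[OF computable_bounded_ex[OF computable_Not[OF assms(1)] assms(2)]] by simp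

lemma computable_bounded_ex_le [computable_intros]:
  fixes n :: "_ \<Rightarrow> nat"
  assumes "computable (\<lambda>z. P (fst z) (snd z))" "computable n"
  shows "computable (\<lambda>x. \<exists>i\<le>n x. P x i)"
  using computable_bounded_ex[OF assms(1) computable_Suc[OF assms(2)]] by (simp add: less_Suc_eq_le)

lemma computable_bounded_all_le [computable_intros]:
  fixes n :: "_ \<Rightarrow> nat"
  assumes "computable (\<lambda>z. P (fst z) (snd z))" "computable n"
  shows "computable (\<lambda>x. \<forall>i\<le>n x. P x i)"
  using computable_bounded_all[OF assms(1) computable_Suc[OF assms(2)]] by (simp add: less_Suc_eq_le)

lemma computable_bounded_Least [computable_intros]:
  fixes n :: "_ \<Rightarrow> nat"
  assumes P: "computable (\<lambda>z. P (fst z) (snd z))" and n: "computable n"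
  shows "computable (\<lambda>x. if \<exists>i<n x. P x i then Suc (LEAST i. P x i) else 0)"
proof -
  let ?rec = "\<lambda>Q. rec_nat 0 (\<lambda>i a. if a = 0 \<and> Q i then Suc i else a)"
  have "?rec Q k = (if \<exists>i<k. Q i then Suc (LEAST i. Q i) else 0)" for Q k
  proof (induction k)
    case (Suc k)
    show ?case
    proof (cases "\<exists>i<k. Q i")
      case True
      then show ?thesis using Suc by (auto simp: less_Suc_eq)
    next
      case False
      then have "Q k \<Longrightarrow> (LEAST i. Q i) = k"
        by (intro Least_equality) (use not_le in auto)
      then show ?thesis using Suc False by (auto simp: less_Suc_eq)
    qed
  qed simp
  moreover have "computable (\<lambda>x. ?rec (P x) (n x))"
    by (intro computable_intros computable_comp2[OF P] n)
  ultimately show ?thesis by simp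
qed

lemma computable_even [computable_intros]:
  assumes "computable n" shows "computable (\<lambda>x. even (n x :: nat))"
proof -
  have "rec_nat True (\<lambda>_. Not) k = even k" for k by (induction k) auto
  moreover have "computable (\<lambda>x. rec_nat True (\<lambda>_. Not) (n x))"
    by (intro computable_intros assms)
  ultimately show ?thesis by simp
qed

lemma computable_half [computable_intros]:
  assumes "computable n" shows "computable (\<lambda>x. n x div 2 :: nat)"
proof -
  have "rec_nat 0 (\<lambda>i a. if even i then a else Suc a) k = k div 2" for k by (induction k) auto
  moreover have "computable (\<lambda>x. rec_nat 0 (\<lambda>i a. if even i then a else Suc a) (n x))"
    by (intro computable_intros assms)
  ultimately show ?thesis by simp
qed

lemma computable_point_if_computable: "computable u \<Longrightarrow> computable_point u"
  by (simp add: computable_def computable_point_def enc_nat_def)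

section \<open>Evaluation with bounded resources\<close>

text \<open>\<open>run t q e xs\<close> evaluates the program \<open>e\<close> while only asking the oracle for values below
  \<open>t\<close> and searching below \<open>t\<close>; the result is \<open>0\<close> if this yields no value, and otherwise one more
  than the value. For each fixed program \<open>e\<close> this is a total computable function, which makes
  computations relative to a point of Baire space available as approximations on its prefixes.\<close>

fun run :: "nat \<Rightarrow> baire \<Rightarrow> recf \<Rightarrow> nat list \<Rightarrow> nat" where
  "run t q Zero xs = 1"
| "run t q Succ xs = (if length xs = 1 then Suc (Suc (ext xs 0)) else 0)"
| "run t q (Proj i) xs = (if i < length xs then Suc (ext xs i) else 0)"
| "run t q Query xs = (if length xs = 1 \<and> ext xs 0 < t then Suc (q (ext xs 0)) else 0)"
| "run t q (Comp f gs) xs =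
    (if \<forall>g\<in>set gs. run t q g xs \<noteq> 0 then run t q f (map (\<lambda>g. run t q g xs - 1) gs) else 0)"
| "run t q (PrimRec f g) xs =
    (if xs = [] then 0
     else rec_nat (run t q f (tl xs))
       (\<lambda>n r. if r = 0 then 0 else run t q g (n # (r - 1) # tl xs)) (ext xs 0))"
| "run t q (Mu f) xs =
    (if \<exists>n<t. run t q f (n # xs) = 1 \<and> (\<forall>m<n. 1 < run t q f (m # xs))
     then Suc (LEAST n. run t q f (n # xs) = 1 \<and> (\<forall>m<n. 1 < run t q f (m # xs))) else 0)"

lemma run_cong:
  assumes "\<And>i. i < t \<Longrightarrow> q i = q' i"
  shows "run t q e xs = run t q' e xs"
  by (induction e arbitrary: xs) (auto simp: assms cong: map_cong if_cong)

lemma if_eq_SucD: "(if c then a else 0) = Suc y \<Longrightarrow> c \<and> a = Suc y"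
  by (simp split: if_splits)

lemma run_sound: "run t q e xs = Suc y \<Longrightarrow> recf_eval q e xs y"
proof (induction e arbitrary: xs y)
  case Zero
  then show ?case using recf_eval.Zero by simp
next
  case Succ
  then obtain x where "xs = [x]" by (cases xs) (auto split: if_splits)
  then show ?case using Succ by (auto simp: ext_def intro: recf_eval.Succ)
next
  case (Proj i)
  then show ?case using recf_eval.Proj by (auto simp: ext_def split: if_splits)
next
  case Query
  then obtain x where "xs = [x]" by (cases xs) (auto split: if_splits)
  then show ?case using Query recf_eval.Query by (auto simp: ext_def split: if_splits)
next
  case (Comp f gs)
  let ?ys = "map (\<lambda>g. run t q g xs - 1) gs"
  note conj = if_eq_SucD[OF Comp.prems[unfolded run.simps(5)]]
  note nz = conj[THEN conjunct1] and y = conj[THEN conjunct2]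
  have "recf_eval q g xs (run t q g xs - 1)" if "g \<in> set gs" for g
    by (rule Comp.IH(2)[OF that]) (use bspec[OF nz that] in simp)
  then have "list_all2 (\<lambda>g y. recf_eval q g xs y) gs ?ys"
    by (simp add: list_all2_conv_all_nth)
  then show ?case using Comp.IH(1)[OF y] recf_eval.Comp by blast
next
  case (PrimRec f g)
  then obtain n xs' where xs: "xs = n # xs'" by (cases xs) (auto split: if_splits)
  let ?r = "rec_nat (run t q f xs') (\<lambda>n r. if r = 0 then 0 else run t q g (n # (r - 1) # xs'))"
  have "?r k = Suc z \<Longrightarrow> recf_eval q (PrimRec f g) (k # xs') z" for k z
  proof (induction k arbitrary: z)
    case 0
    then show ?case using PrimRec.IH(1) recf_eval.PrimRec_0 by simp
  next
    case (Suc k)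
    then obtain w where w: "?r k = Suc w" by (cases "?r k") auto
    have "run t q g (k # w # xs') = Suc z" using Suc.prems by (simp add: w)
    then show ?case using Suc.IH[OF w] PrimRec.IH(2) recf_eval.PrimRec_Suc by blast
  qed
  then show ?case using PrimRec.prems xs by (simp add: ext_def cong: if_cong)
next
  case (Mu f)
  let ?P = "\<lambda>n. run t q f (n # xs) = 1 \<and> (\<forall>m<n. 1 < run t q f (m # xs))"
  note conj = if_eq_SucD[OF Mu.prems[unfolded run.simps(7)]]
  have y: "(LEAST n. ?P n) = y" using conj[THEN conjunct2] by (rule Suc_inject)
  have "\<exists>n. ?P n" using conj[THEN conjunct1] by (elim exE conjE) (intro exI conjI)
  then have Py: "?P y" unfolding y[symmetric] by (rule LeastI_ex)
  have "\<exists>z. recf_eval q f (m # xs) (Suc z)" if "m < y" for m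
  proof -
    have "1 < run t q f (m # xs)" using Py that by blast
    then have "run t q f (m # xs) = Suc (Suc (run t q f (m # xs) - 2))" by linarith
    then show ?thesis using Mu.IH by blast
  qed
  moreover have "recf_eval q f (y # xs) 0"
    by (rule Mu.IH) (use Py in simp)
  ultimately show ?case by (intro recf_eval.Mu) auto
qed

lemma run_complete: "recf_eval q e xs y \<Longrightarrow> \<exists>t. \<forall>t'\<ge>t. run t' q e xs = Suc y"
proof (induction rule: recf_eval.induct)
  case (Query x)
  then show ?case by (auto simp: ext_def intro: exI[of _ "Suc x"])
next
  case (Comp xs gs ys f z)
  have "\<exists>t. \<forall>i<length gs. \<forall>t'\<ge>t. run t' q (gs ! i) xs = Suc (ys ! i)"
  proof -
    have "\<forall>i<length gs. \<exists>t. \<forall>t'\<ge>t. run t' q (gs ! i) xs = Suc (ys ! i)"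
      using Comp.IH(1) by (auto simp: list_all2_conv_all_nth)
    then obtain T where T: "\<forall>i<length gs. \<forall>t'\<ge>T i. run t' q (gs ! i) xs = Suc (ys ! i)" by metis
    have "\<forall>i<length gs. T i \<le> Max (T ` {..<length gs})" by auto
    then show ?thesis using T by (meson order_trans)
  qed
  then obtain t1 where t1: "\<And>i t'. i < length gs \<Longrightarrow> t1 \<le> t' \<Longrightarrow> run t' q (gs ! i) xs = Suc (ys ! i)"
    by blast
  obtain t2 where t2: "\<And>t'. t2 \<le> t' \<Longrightarrow> run t' q f ys = Suc z" using Comp.IH(2) by blast
  have "run t' q (Comp f gs) xs = Suc z" if "t' \<ge> max t1 t2" for t'
  proof -
    have "map (\<lambda>g. run t' q g xs - 1) gs = ys"
      using t1[of _ t'] that Comp.IH(1) by (auto simp: list_all2_conv_all_nth intro!: nth_equalityI)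
    moreover have "\<forall>g\<in>set gs. run t' q g xs \<noteq> 0"
      using t1[of _ t'] that by (auto simp: in_set_conv_nth)
    ultimately show ?thesis using t2[of t'] that by simp
  qed
  then show ?case by blast
next
  case (PrimRec_0 f xs y g)
  then show ?case by (auto simp: ext_def)
next
  case (PrimRec_Suc f g n xs y z)
  then obtain t1 t2 where t: "\<And>t'. t1 \<le> t' \<Longrightarrow> run t' q (PrimRec f g) (n # xs) = Suc y"
    "\<And>t'. t2 \<le> t' \<Longrightarrow> run t' q g (n # y # xs) = Suc z" by blast
  have "run t' q (PrimRec f g) (Suc n # xs) = Suc z" if "t' \<ge> max t1 t2" for t'
    using t(1)[of t'] t(2)[of t'] that by (auto simp: ext_def cong: if_cong)
  then show ?case by blast
next
  case (Mu f n xs)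
  have "\<exists>t. \<forall>m<n. \<forall>t'\<ge>t. 1 < run t' q f (m # xs)"
  proof -
    have "\<forall>m. \<exists>t. m < n \<longrightarrow> (\<forall>t'\<ge>t. 1 < run t' q f (m # xs))"
      using Mu.IH(2) by (metis One_nat_def Suc_less_eq zero_less_Suc)
    then obtain T where T: "\<forall>m. m < n \<longrightarrow> (\<forall>t'\<ge>T m. 1 < run t' q f (m # xs))" by metis
    have "\<forall>m<n. T m \<le> Max (T ` {..<n})" by auto
    then show ?thesis using T by (meson order_trans)
  qed
  then obtain t1 where t1: "\<And>m t'. m < n \<Longrightarrow> t1 \<le> t' \<Longrightarrow> 1 < run t' q f (m # xs)" by blast
  obtain t2 where t2: "\<And>t'. t2 \<le> t' \<Longrightarrow> run t' q f (n # xs) = 1" using Mu.IH(1) by auto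
  have "run t' q (Mu f) xs = Suc n" if "t' \<ge> max (Suc n) (max t1 t2)" for t'
  proof -
    let ?P = "\<lambda>n. run t' q f (n # xs) = 1 \<and> (\<forall>m<n. 1 < run t' q f (m # xs))"
    have P: "?P n" using t1[of _ t'] t2[of t'] that by simp
    have "(LEAST n. ?P n) = n"
    proof (rule Least_equality[of ?P, OF P])
      fix m assume "?P m"
      then show "n \<le> m" using P by (metis less_irrefl not_le)
    qed
    then show ?thesis using P that by (auto simp: Suc_le_eq)
  qed
  then show ?case by blast
qed (auto simp: ext_def)

text \<open>The argument type of the terms changes under binders, but an induction hypothesis has only one
  type. So the induction is on a single function whose argument consists of the bound, the parameter of the
  oracle and the argument list; every other instance is a composition with it.\<close>

lemma computable_run [computable_intros]:
  assumes q: "computable (\<lambda>z. q (fst z) (snd z))" and t: "computable t" and xs: "computable xs"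
  shows "computable (\<lambda>x. run (t x) (q x) e (xs x))"
proof -
  let ?C = "\<lambda>e. computable (\<lambda>z. run (fst (fst z)) (q (snd (fst z))) e (snd z))"
  have inst: "computable (\<lambda>x. run (t' x) (q (w x)) e (xs' x))"
    if C: "?C e" and "computable t'" "computable w" "computable xs'"
    for e and t' :: "'b :: coded \<Rightarrow> nat" and w xs'
    using computable_comp[OF C computable_Pair[OF computable_Pair[OF that(2,3)] that(4)]] by simp
  have "?C e"
  proof (induction e)
    case (Comp f gs)
    have "computable (\<lambda>z. map (\<lambda>g. run (fst (fst z)) (q (snd (fst z))) g (snd z) - 1) gs')"
      if "set gs' \<subseteq> set gs" for gs'
      using that by (induction gs') (auto intro!: computable_intros Comp)
    moreover have "computable (\<lambda>z. \<forall>g\<in>set gs'. run (fst (fst z)) (q (snd (fst z))) g (snd z) \<noteq> 0)"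
      if "set gs' \<subseteq> set gs" for gs'
      using that by (induction gs') (auto intro!: computable_intros Comp)
    ultimately show ?case
      unfolding run.simps by (intro computable_If computable_const inst[OF Comp.IH(1)] computable_intros) auto
  next
    case (PrimRec f g)
    have "computable (\<lambda>x. \<not> (snd x :: nat list) = [])" by (intro computable_intros)
    show ?case
      unfolding run.simps
      by (intro computable_intros inst[OF PrimRec.IH(1)] inst[OF PrimRec.IH(2)])
  next
    case (Mu f)
    show ?case
      unfolding run.simps by (intro computable_intros inst[OF Mu.IH])
  qed (unfold run.simps, (intro computable_intros computable_comp2[OF q])+)
  then show ?thesis
    using inst[OF _ t computable_id xs] by simp
qed

section \<open>Names of clopen sets and of open sets\<close>

abbreviation clopen_rep :: "(baire \<Rightarrow> nat) rep_space" where
  "clopen_rep \<equiv> fun_rep rep_baire rep_two"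

lemma query_code_eq: "query_code n p k = list_encode (n # pre p k)"
  by (simp add: query_code_def pre_def)

lemma query_code_cong: "(\<And>j. j < k \<Longrightarrow> p j = q j) \<Longrightarrow> query_code n p k = query_code n q k"
  using pre_cong[of k p q] by (simp add: query_code_eq)

definition modulus :: "baire \<Rightarrow> baire \<Rightarrow> nat" where
  "modulus b y = (LEAST k. b (query_code 0 y k) \<noteq> 0)"

text \<open>Only the value at \<open>0\<close> of an output of type \<open>2\<close> matters, so the part of a name that answers queries with
  \<open>n = 0\<close> determines the clopen set; the rest must just be defined.\<close>

lemma clopen_rep_iff:
  "clopen_rep b = Some g \<longleftrightarrow> (\<forall>y. (\<forall>n. \<exists>k. b (query_code n y k) \<noteq> 0) \<and> g y \<in> {0, 1} \<and>
    b (query_code 0 y (modulus b y)) = Suc (g y))"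
proof -
  have "(\<exists>q. associate_apply b y = Some q \<and> rep_two q = Some v) \<longleftrightarrow>
      (\<forall>n. \<exists>k. b (query_code n y k) \<noteq> 0) \<and> v \<in> {0, 1} \<and>
      b (query_code 0 y (modulus b y)) = Suc v" for y v
  proof (cases "\<forall>n. \<exists>k. b (query_code n y k) \<noteq> 0")
    case True
    then have "b (query_code 0 y (modulus b y)) \<noteq> 0"
      unfolding modulus_def by (metis (mono_tags, lifting) LeastI_ex)
    then show ?thesis
      using True
      by (auto simp: associate_apply_def rep_two_def subspace_rep_def rep_nat_def modulus_def)
  next
    case False
    have "associate_apply b y = None" unfolding associate_apply_def using False by (rule if_not_P)
    then show ?thesis using False by (metis option.distinct(1))
  qed
  moreover have "ran rep_baire = UNIV" by (auto simp: ran_def rep_baire_def)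
  ultimately show ?thesis
    by (auto simp: fun_rep_eq_Some_iff fun_name_def rep_baire_def)
qed

lemma clopen_rep_modulus:
  assumes "clopen_rep b = Some g"
  shows "b (query_code 0 y (modulus b y)) = Suc (g y)" "j < modulus b y \<Longrightarrow> b (query_code 0 y j) = 0"
  using assms not_less_Least unfolding clopen_rep_iff modulus_def by blast+

lemma modulus_eqI:
  assumes "b (query_code 0 y m) \<noteq> 0" "\<And>j. j < m \<Longrightarrow> b (query_code 0 y j) = 0"
  shows "modulus b y = m"
  unfolding modulus_def using assms by (intro Least_equality) (auto simp: not_less[symmetric])

lemma clopen_locally_constant:
  assumes b: "clopen_rep b = Some g" and y: "\<And>j. j < modulus b y \<Longrightarrow> y j = y' j"
  shows "g y' = g y"
proof -
  have same: "query_code 0 y' k = query_code 0 y k" if "k \<le> modulus b y" for k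
    using y that by (intro query_code_cong) auto
  then have "modulus b y' = modulus b y"
    using clopen_rep_modulus(1)[OF b, of y] clopen_rep_modulus(2)[OF b, of _ y]
    by (intro modulus_eqI) auto
  then show ?thesis
    using clopen_rep_modulus(1)[OF b, of y] clopen_rep_modulus(1)[OF b, of y'] same by simp
qed

lemma clopen_rep_zero: "clopen_rep (\<lambda>_. 1) = Some (\<lambda>_. 0)"
  by (simp add: clopen_rep_iff)

text \<open>The element of Sierpinski space that a name of an open set computes from a name \<open>b\<close> is \<open>\<top>\<close> iff
  some answer, decremented by one, is nonzero.\<close>

definition accepts :: "baire \<Rightarrow> baire \<Rightarrow> bool" where
  "accepts u b \<longleftrightarrow> (\<exists>n k. 2 \<le> u (query_code n b k) \<and> (\<forall>j<k. u (query_code n b j) = 0))"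

lemma accepts_iff_associate_apply:
  assumes "associate_apply u b = Some q"
  shows "accepts u b \<longleftrightarrow> q \<noteq> (\<lambda>_. 0)"
proof -
  define m where "m n = (LEAST k. u (query_code n b k) \<noteq> 0)" for n
  have ex: "\<forall>n. \<exists>k. u (query_code n b k) \<noteq> 0" and q: "q = (\<lambda>n. u (query_code n b (m n)) - 1)"
    using assms by (auto simp: associate_apply_def m_def split: if_splits)
  have m: "u (query_code n b (m n)) \<noteq> 0" "j < m n \<Longrightarrow> u (query_code n b j) = 0" for n j
    using ex LeastI_ex[of "\<lambda>k. u (query_code n b k) \<noteq> 0"] not_less_Least unfolding m_def by blast+
  have "k = m n" if "2 \<le> u (query_code n b k)" "\<forall>j<k. u (query_code n b j) = 0" for n k
    using that m(1)[of n] m(2)[of k n] by (cases k "m n" rule: linorder_cases) auto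
  then have "accepts u b \<longleftrightarrow> (\<exists>n. 2 \<le> u (query_code n b (m n)))"
    unfolding accepts_def using m by blast
  also have "\<dots> \<longleftrightarrow> q \<noteq> (\<lambda>_. 0)"
  proof -
    have "2 \<le> v \<longleftrightarrow> v - 1 \<noteq> 0" for v :: nat by arith
    then show ?thesis by (simp add: q fun_eq_iff)
  qed
  finally show ?thesis .
qed

lemma opens_rep_accepts:
  assumes "opens_rep X u = Some U" "X b = Some x"
  shows "U x \<longleftrightarrow> accepts u b"
proof -
  obtain q where q: "associate_apply u b = Some q" "sierpinski q = Some (U x)"
    using assms by (auto simp: fun_rep_eq_Some_iff fun_name_def)
  then show ?thesis using accepts_iff_associate_apply[OF q(1)] by (simp add: sierpinski_def)
qed

lemma opens_repI:
  assumes "U \<in> extensional (ran X)"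
    and "\<And>b x n. X b = Some x \<Longrightarrow> \<exists>k. u (query_code n b k) \<noteq> 0"
    and "\<And>b x. X b = Some x \<Longrightarrow> U x \<longleftrightarrow> accepts u b"
  shows "opens_rep X u = Some U"
  unfolding fun_rep_eq_Some_iff fun_name_def
proof (intro conjI allI impI)
  fix b x assume x: "X b = Some x"
  then obtain q where q: "associate_apply u b = Some q"
    using assms(2) by (auto simp: associate_apply_def)
  then show "\<exists>q. associate_apply u b = Some q \<and> sierpinski q = Some (U x)"
    using accepts_iff_associate_apply[OF q] assms(3)[OF x] by (simp add: sierpinski_def)
qed (rule assms(1))

section \<open>Clopen sets that reveal a point of Baire space\<close>

text \<open>The set of all \<open>y\<close> that begin with a code of \<open>p(0)\<dots>p(i - 1)\<close>, then \<open>p(i)\<close> zeros, then \<open>c\<close>, for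
  some \<open>i\<close>. As \<open>y(0)\<close> determines \<open>i\<close>, this set is clopen. For \<open>c = 0\<close> it is made empty, which
  gives the limit for \<open>c \<rightarrow> \<infinity>\<close>.\<close>

definition spike :: "baire \<Rightarrow> nat \<Rightarrow> baire \<Rightarrow> nat" where
  "spike p c y = (let \<sigma> = list_decode (y 0); i = length \<sigma> in
    of_bool (\<sigma> = pre p i \<and> (\<forall>j<p i. y (Suc j) = 0) \<and> y (Suc (p i)) = c \<and> 0 < c))"

text \<open>A name of \<open>spike p c\<close> that delays its answer near a code of \<open>p(0)\<dots>p(i - 1)\<close> until the coordinate
  that is to be compared with \<open>c\<close> has been read. The code \<open>z\<close> lists the queried output position followed by
  a prefix of \<open>y\<close>, hence the offsets: \<open>y(0)\<close> is entry \<open>1\<close> of the list, and a prefix of length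
  \<open>p(i) + 2\<close> makes a list of length \<open>p(i) + 3\<close>.\<close>

definition spike_name :: "baire \<Rightarrow> nat \<Rightarrow> baire" where
  "spike_name p c z = (let l = list_decode z; \<sigma> = list_decode (ext l 1); i = length \<sigma> in
    if length l \<le> 1 then 0
    else if \<sigma> = pre p i then if p i + 3 \<le> length l then Suc (spike p c (ext (tl l))) else 0
    else 1)"

lemma spike_zero [simp]: "spike p 0 = (\<lambda>_. 0)"
  by (simp add: spike_def fun_eq_iff)

lemma spike_cong:
  assumes "\<And>i. i \<le> length (list_decode (y 0)) \<Longrightarrow> p i = p' i"
  shows "spike p c y = spike p' c y"
  using assms pre_cong[of "length (list_decode (y 0))" p p'] by (simp add: spike_def Let_def)

lemma spike_name_query_code:
  "spike_name p c (query_code n y k) = (let \<sigma> = list_decode (y 0); i = length \<sigma> in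
    if k = 0 \<or> \<sigma> = pre p i \<and> k < p i + 2 then 0 else Suc (spike p c y))"
proof (cases "k = 0")
  case True
  then show ?thesis by (simp add: spike_name_def query_code_eq pre_def)
next
  case False
  let ?i = "length (list_decode (y 0))"
  have y0: "ext (n # pre y k) (Suc 0) = y 0" using False by (simp add: ext_Cons)
  have "spike p c (ext (pre y k)) = spike p c y" if "k \<ge> p ?i + 2"
    using that by (simp add: spike_def Let_def)
  then show ?thesis
    using False by (simp add: spike_name_def query_code_eq y0 Let_def) (simp add: spike_def Let_def)
qed

lemma clopen_rep_spike_name: "clopen_rep (spike_name p c) = Some (spike p c)"
  unfolding clopen_rep_iff
proof (intro allI conjI)
  fix y n
  have ex: "\<exists>k. spike_name p c (query_code n y k) \<noteq> 0" for n
    by (rule exI[of _ "p (length (list_decode (y 0))) + 2"]) (simp add: spike_name_query_code Let_def)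
  show "\<exists>k. spike_name p c (query_code n y k) \<noteq> 0" by (rule ex)
  show "spike p c y \<in> {0, 1}" by (simp add: spike_def Let_def)
  have "spike_name p c (query_code 0 y (modulus (spike_name p c) y)) \<noteq> 0"
    unfolding modulus_def by (rule LeastI_ex) (rule ex)
  then show "spike_name p c (query_code 0 y (modulus (spike_name p c) y)) = Suc (spike p c y)"
    unfolding spike_name_query_code Let_def by (simp split: if_splits)
qed

text \<open>The two names differ only on prefixes in which \<open>Suc k\<close> occurs, and the code of a list exceeds
  its elements. This is why spikes with a large parameter are hidden from a process that reads only \<open>k\<close>
  entries of the name.\<close>

lemma spike_name_agrees_with_zero:
  assumes "z < k"
  shows "spike_name p (Suc k) z = spike_name p 0 z"
proof -
  let ?l = "list_decode z"
  have "spike p (Suc k) (ext (tl ?l)) = 0"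
  proof (rule ccontr)
    assume "spike p (Suc k) (ext (tl ?l)) \<noteq> 0"
    then obtain j where "ext (tl ?l) j = Suc k" by (auto simp: spike_def Let_def split: if_splits)
    then have "Suc k \<in> set (tl ?l)" by (metis ext_def nat.distinct(1) nth_mem)
    then have "Suc k \<in> set ?l" by (cases ?l) auto
    then have "Suc k < z" using less_list_encode by fastforce
    then show False using assms by simp
  qed
  then show ?thesis by (simp add: spike_name_def Let_def)
qed

text \<open>Entry \<open>z\<close> of the name involves \<open>p\<close> up to the length of a list whose code is below \<open>z\<close>.\<close>

lemma spike_name_cong:
  assumes "z < k" and p: "\<And>i. i < k \<Longrightarrow> p i = p' i"
  shows "spike_name p c z = spike_name p' c z"
proof (cases "length (list_decode z) \<le> 1")
  case False
  let ?l = "list_decode z"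
  let ?\<sigma> = "list_decode (ext ?l 1)"
  have "ext ?l 1 \<in> set ?l" using False by (simp add: ext_def)
  then have "ext ?l 1 < z" using less_list_encode by fastforce
  then have i: "length ?\<sigma> < k" using length_le_list_encode[of ?\<sigma>] assms(1) by simp
  have "ext (tl ?l) 0 = ext ?l 1" using False by (simp add: ext_def nth_tl)
  then have "spike p c (ext (tl ?l)) = spike p' c (ext (tl ?l))"
    using i by (intro spike_cong p) simp
  moreover have "pre p (length ?\<sigma>) = pre p' (length ?\<sigma>)"
    using i by (intro pre_cong p) simp
  ultimately show ?thesis using p[OF i] by (simp add: spike_name_def Let_def)
qed (simp add: spike_name_def Let_def)

text \<open>The point that a code of \<open>p(0)\<dots>p(i - 1)\<close> and infinitely many zeros make: the spike number \<open>i\<close> branches off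
  from it after \<open>p(i)\<close> zeros, so for \<open>c > 0\<close> no neighbourhood of it that is given by at most \<open>p(i) + 1\<close>
  coordinates is disjoint from the spiked set.\<close>

definition below_spike :: "baire \<Rightarrow> nat \<Rightarrow> baire" where
  "below_spike p i = ext [list_encode (pre p i)]"

lemma spike_below_spike: "spike p c (below_spike p i) = 0"
  by (auto simp: spike_def below_spike_def ext_def Let_def)

lemma spike_at_spike: "0 < c \<Longrightarrow> spike p c ((below_spike p i)(Suc (p i) := c)) = 1"
  by (simp add: spike_def below_spike_def ext_def Let_def)

lemma spike_nonzero: "spike p (Suc k) \<noteq> (\<lambda>_. 0)"
  using spike_at_spike[of "Suc k" p 0] by (metis zero_less_Suc zero_neq_one)

lemma computable_spike [computable_intros]:
  assumes "computable (\<lambda>z. p (fst z) (snd z))" "computable c" "computable (\<lambda>z. y (fst z) (snd z))"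
  shows "computable (\<lambda>x. spike (p x) (c x) (y x))"
  unfolding spike_def Let_def
  by (intro computable_intros computable_comp2[OF assms(1)] computable_comp2[OF assms(3)] assms(2))

lemma computable_spike_name [computable_intros]:
  assumes "computable (\<lambda>z. p (fst z) (snd z))" "computable c" "computable w"
  shows "computable (\<lambda>x. spike_name (p x) (c x) (w x))"
  unfolding spike_name_def Let_def
  by (intro computable_intros computable_comp2[OF assms(1)] computable_comp[OF assms(3) computable_fst]
    assms(2,3))

section \<open>The diagonal open set\<close>

text \<open>The first \<open>t\<close> entries of the name \<open>b\<close> suffice to see that \<open>m\<close> is the modulus at \<open>y\<close>.\<close>

definition seen :: "baire \<Rightarrow> nat \<Rightarrow> baire \<Rightarrow> nat \<Rightarrow> bool" where
  "seen b t y m \<longleftrightarrow> (\<forall>j\<le>m. query_code 0 y j < t) \<and> b (query_code 0 y m) \<noteq> 0 \<and>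
    (\<forall>j<m. b (query_code 0 y j) = 0)"

lemma seen_cong:
  assumes "\<And>z. z < t \<Longrightarrow> b z = b' z"
  shows "seen b t y m = seen b' t y m"
  using assms by (auto simp: seen_def)

lemma seen_modulus: "seen b t y m \<Longrightarrow> modulus b y = m"
  unfolding seen_def by (intro modulus_eqI) auto

lemma eventually_seen:
  assumes "clopen_rep b = Some g"
  shows "\<exists>t0. \<forall>t\<ge>t0. seen b t y (modulus b y)"
proof -
  let ?t0 = "Suc (Max (query_code 0 y ` {..modulus b y}))"
  have "query_code 0 y j < t" if "j \<le> modulus b y" "?t0 \<le> t" for j t
    using that by (auto simp: Suc_le_eq)
  then have "seen b t y (modulus b y)" if "?t0 \<le> t" for t
    using clopen_rep_modulus[OF assms] that by (simp add: seen_def)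
  then show ?thesis by blast
qed

text \<open>A bound on the codes of all lists of length \<open>t\<close> with entries up to \<open>t\<close>, by which a quantifier over these lists becomes a bounded quantifier over numbers.\<close>

definition replicate_bound :: "nat \<Rightarrow> nat" where
  "replicate_bound t = list_encode (rec_nat [] (\<lambda>_ xs. t # xs) t)"

lemma prod_encode_mono: "a \<le> a' \<Longrightarrow> b \<le> b' \<Longrightarrow> prod_encode (a, b) \<le> prod_encode (a', b')"
proof -
  assume *: "a \<le> a'" "b \<le> b'"
  have "mono triangle" by (rule monoI) (unfold triangle_def, intro div_le_mono mult_le_mono, simp_all)
  then have "triangle (a + b) \<le> triangle (a' + b')" using * by (simp add: monoD)
  then show ?thesis using * by (simp add: prod_encode_def)
qed

lemma list_encode_le_replicate_bound:
  assumes "length xs = t" "\<And>x. x \<in> set xs \<Longrightarrow> x \<le> t"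
  shows "list_encode xs \<le> replicate_bound t"
proof -
  have "list_encode xs \<le> list_encode (rec_nat [] (\<lambda>_ xs. t # xs) (length xs))"
    using assms(2) by (induction xs) (auto intro: prod_encode_mono)
  then show ?thesis using assms(1) by (simp add: replicate_bound_def)
qed

text \<open>The closed set \<open>D\<close> is \<open>{p. \<forall>s. T p s}\<close>, and \<open>\<exists>s. acc p b s\<close> means that the clopen set named by \<open>b\<close> is
  in the open set belonging to \<open>p\<close>. What is decided at stage \<open>s\<close> depends on \<open>p\<close> below
  \<open>\<mu> s\<close> and on \<open>b\<close> below \<open>s\<close>.\<close>

locale diagonalisation =
  fixes \<mu> :: "nat \<Rightarrow> nat" and T :: "baire \<Rightarrow> nat \<Rightarrow> bool" and acc :: "baire \<Rightarrow> baire \<Rightarrow> nat \<Rightarrow> bool"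
  assumes mu_ge: "s \<le> \<mu> s"
    and T_local: "(\<And>i. i < \<mu> s \<Longrightarrow> p i = p' i) \<Longrightarrow> T p s = T p' s"
    and acc_local: "(\<And>i. i < \<mu> s \<Longrightarrow> p i = p' i) \<Longrightarrow> (\<And>z. z < s \<Longrightarrow> b z = b' z) \<Longrightarrow>
      acc p b s = acc p' b' s"
    and acc_zero: "(\<And>s. T p s) \<Longrightarrow> clopen_rep a = Some (\<lambda>_. 0) \<Longrightarrow> \<exists>s. acc p a s"
begin

text \<open>\<open>k\<close> is the number of entries after which the slow name of \<open>0\<close> is first accepted. Taking the least
  \<open>k\<close> matters: for fixed \<open>p\<close> and \<open>k \<rightarrow> \<infinity>\<close> the sets \<open>spike p (Suc k)\<close> converge to \<open>0\<close>, which must not be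
  in the closure of the test sets.\<close>

definition stage :: "baire \<Rightarrow> nat \<Rightarrow> bool" where
  "stage p k \<longleftrightarrow> acc p (spike_name p 0) k \<and> (\<forall>j<k. \<not> acc p (spike_name p 0) j)"

definition test :: "baire \<Rightarrow> baire \<Rightarrow> nat" where
  "test p = spike p (Suc (LEAST k. acc p (spike_name p 0) k))"

lemma stage_test: "stage p k \<Longrightarrow> test p = spike p (Suc k)"
  unfolding stage_def test_def
  by (subst Least_equality[of _ k]) (auto simp: not_less[symmetric])

lemma ex_stage:
  assumes "\<And>s. T p s"
  shows "\<exists>k. stage p k"
proof -
  have "\<exists>k. acc p (spike_name p 0) k"
    using acc_zero[OF assms] clopen_rep_spike_name[of p 0] by simp
  then show ?thesis
    unfolding stage_def using exists_least_iff[of "\<lambda>k. acc p (spike_name p 0) k"] by blast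
qed

text \<open>At its stage \<open>k\<close>, the acceptance of the slow name of \<open>0\<close> uses only entries that this name
  shares with the name of the spiked set.\<close>

lemma test_accepted:
  assumes "\<And>s. T p s"
  shows "\<exists>b k. clopen_rep b = Some (test p) \<and> acc p b k"
proof -
  obtain k where k: "stage p k" using ex_stage[OF assms] by blast
  have "acc p (spike_name p (Suc k)) k = acc p (spike_name p 0) k"
    by (rule acc_local) (auto simp: spike_name_agrees_with_zero)
  then show ?thesis using k clopen_rep_spike_name stage_test[OF k] by (auto simp: stage_def)
qed

lemma acc_spike_name_cong:
  assumes "\<And>i. i < \<mu> k \<Longrightarrow> p i = p' i"
  shows "acc p (spike_name p c) k = acc p' (spike_name p' c) k"
  by (rule acc_local[OF assms]) (auto intro!: spike_name_cong[of _ k] assms order_less_le_trans[OF _ mu_ge])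

text \<open>Three ways to see from the first \<open>t\<close> entries of \<open>b\<close> that \<open>b\<close> does not name \<open>test p\<close> for a \<open>p \<in> D\<close>:
  \<open>p \<notin> D\<close>; the modulus of \<open>b\<close> at a point below spike \<open>i\<close> is too small for \<open>p(i)\<close>; or the value at some
  eventually zero point is wrong. The first and the third use only \<open>p(0)\<dots>p(i - 1)\<close>, the second also \<open>p(i)\<close>,
  and it persists if \<open>p(i)\<close> grows.\<close>

definition conflict :: "baire \<Rightarrow> nat \<Rightarrow> baire \<Rightarrow> nat \<Rightarrow> bool" where
  "conflict p i b t \<longleftrightarrow>
    (\<exists>s\<le>i. \<mu> s \<le> i \<and> \<not> T p s) \<or>
    (\<exists>m\<le>Suc (p i). seen b t (below_spike p i) m) \<or>
    (\<exists>k\<le>i. (\<forall>j\<le>k. \<mu> j \<le> i) \<and> stage p k \<and> (\<exists>d<t. \<exists>m\<le>t.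
      length (list_decode (ext (list_decode d) 0)) < i \<and> seen b t (ext (list_decode d)) m \<and>
      b (query_code 0 (ext (list_decode d)) m) \<noteq> Suc (spike p (Suc k) (ext (list_decode d)))))"

text \<open>Every \<open>p\<close> is represented by the list of \<open>t\<close> numbers \<open>min t (p j)\<close>. A conflict at \<open>i\<close> counts only if the
  entries before \<open>i\<close> are below \<open>t\<close>, thus were not truncated; then it is also a conflict
  for \<open>p\<close>, whose value at \<open>i\<close> is at least that of the truncated list.\<close>

definition refuted :: "baire \<Rightarrow> nat \<Rightarrow> bool" where
  "refuted b t \<longleftrightarrow> (\<forall>c\<le>replicate_bound t. \<exists>i<t.
    (\<forall>j<i. ext (list_decode c) j < t) \<and> conflict (ext (list_decode c)) i b t)"

lemma stage_cong:
  assumes "\<And>i. i < n \<Longrightarrow> p i = p' i" "\<forall>j\<le>k. \<mu> j \<le> n"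
  shows "stage p k = stage p' k"
proof -
  have "acc p (spike_name p 0) j = acc p' (spike_name p' 0) j" if "j \<le> k" for j
    using assms that by (intro acc_spike_name_cong) (metis order_less_le_trans)
  then show ?thesis by (simp add: stage_def)
qed

lemma conflict_mono:
  assumes "conflict p i b t" and eq: "\<And>j. j < i \<Longrightarrow> p j = p' j" and "p i \<le> p' i"
  shows "conflict p' i b t"
proof -
  have T: "T p s = T p' s" if "\<mu> s \<le> i" for s
    using that by (intro T_local eq) simp
  have below: "below_spike p i = below_spike p' i"
    using pre_cong[of i p p'] eq by (simp add: below_spike_def)
  have stage: "stage p k = stage p' k" if "\<forall>j\<le>k. \<mu> j \<le> i" for k
    using eq that by (rule stage_cong)
  have spike: "spike p c y = spike p' c y" if "length (list_decode (y 0)) < i" for c y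
    using that by (intro spike_cong eq) simp
  have "\<exists>m\<le>Suc (p' i). seen b t (below_spike p' i) m" if "\<exists>m\<le>Suc (p i). seen b t (below_spike p i) m"
    using that assms(3) unfolding below by (meson Suc_le_mono le_trans)
  then show ?thesis
    using assms(1) unfolding conflict_def by (auto simp: T stage spike cong: conj_cong)
qed

text \<open>In the second case, \<open>test p\<close> is \<open>0\<close> at the point below the spike and \<open>1\<close> at a point of the spike, and both
  are in the neighbourhood where the name claims a constant value.\<close>

lemma conflict_sound:
  assumes T: "\<And>s. T p s" and b: "clopen_rep b = Some g" and "conflict p i b t"
  shows "g \<noteq> test p"
proof
  assume g: "g = test p"
  obtain k where k: "stage p k" using ex_stage[OF T] by blast
  note test = stage_test[OF k]
  consider m where "m \<le> Suc (p i)" "seen b t (below_spike p i) m"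
    | k' y m where "stage p k'" "seen b t y m" "b (query_code 0 y m) \<noteq> Suc (spike p (Suc k') y)"
    using assms(3) T unfolding conflict_def by blast
  then show False
  proof cases
    case 1
    have "g ((below_spike p i)(Suc (p i) := Suc k)) = g (below_spike p i)"
      using 1 seen_modulus[OF 1(2)] by (intro clopen_locally_constant[OF b]) auto
    then show False
      using spike_at_spike[of "Suc k" p i] spike_below_spike[of p "Suc k" i] g test by simp
  next
    case 2
    then show False
      using clopen_rep_modulus(1)[OF b, of y] seen_modulus[OF 2(2)] g stage_test[OF 2(1)] by simp
  qed
qed

lemma refuted_sound:
  assumes T: "\<And>s. T p s" and b: "clopen_rep b = Some g" and ref: "refuted b t"
  shows "g \<noteq> test p"
proof -
  define p' where "p' = ext (pre (\<lambda>j. min t (p j)) t)"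
  have p': "p' j = min t (p j)" if "j < t" for j using that by (simp add: p'_def)
  have "list_encode (pre (\<lambda>j. min t (p j)) t) \<le> replicate_bound t"
    by (rule list_encode_le_replicate_bound) (auto simp: pre_def)
  then obtain i where i: "i < t" "\<forall>j<i. p' j < t" "conflict p' i b t"
    using ref unfolding refuted_def p'_def by (metis list_encode_inverse)
  have "conflict p i b t"
  proof (rule conflict_mono[OF i(3)])
    show "p' j = p j" if "j < i" for j
      using i(1,2) that p'[of j] by (metis min.strict_order_iff min_def order_less_trans)
    show "p' i \<le> p i" using p'[OF i(1)] by simp
  qed
  then show ?thesis by (rule conflict_sound[OF T b])
qed

text \<open>From some \<open>t\<close> on, the first \<open>t\<close> entries of \<open>b\<close> refute all prolongations of \<open>\<sigma>\<close>. As the bound on \<open>t\<close> is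
  uniform in the prolongation, it takes compactness to see that the empty sequence is dead.\<close>

definition dead :: "baire \<Rightarrow> nat list \<Rightarrow> bool" where
  "dead b \<sigma> \<longleftrightarrow> (\<exists>t0. \<forall>t\<ge>t0. \<forall>p. pre p (length \<sigma>) = \<sigma> \<longrightarrow>
    (\<exists>i<t. (\<forall>j<i. p j < t) \<and> conflict p i b t))"

lemma pre_eqD: "pre p n = pre q n \<Longrightarrow> i < n \<Longrightarrow> p i = q i"
  by (metis nth_pre)

lemma dead_if_conflict:
  assumes "\<And>t p. t0 \<le> t \<Longrightarrow> pre p (length \<sigma>) = \<sigma> \<Longrightarrow> conflict p (length \<sigma>) b t"
  shows "dead b \<sigma>"
proof -
  have "\<exists>i<t. (\<forall>j<i. p j < t) \<and> conflict p i b t"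
    if t: "t \<ge> max t0 (Suc (max (length \<sigma>) (list_encode \<sigma>)))" and p: "pre p (length \<sigma>) = \<sigma>" for t p
  proof (intro exI conjI allI impI)
    show "conflict p (length \<sigma>) b t" using t by (intro assms p) simp
    show "p j < t" if "j < length \<sigma>" for j
    proof -
      have "p j \<in> set \<sigma>" using p that by (metis nth_mem nth_pre)
      then show ?thesis using less_list_encode[of "p j" \<sigma>] t by (simp add: Suc_le_eq)
    qed
  qed (use t in \<open>simp add: Suc_le_eq\<close>)
  then show ?thesis unfolding dead_def by blast
qed

text \<open>The name has some modulus at the point that belongs to \<open>\<sigma>\<close>, and it refutes all larger next
  entries at once; finitely many next entries remain.\<close>

lemma dead_if_children_dead:
  assumes b: "clopen_rep b = Some g" and "\<And>v. dead b (\<sigma> @ [v])"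
  shows "dead b \<sigma>"
proof -
  let ?y = "ext [list_encode \<sigma>]" and ?i = "length \<sigma>"
  let ?M = "modulus b ?y"
  let ?Q = "\<lambda>p t. \<exists>i<t. (\<forall>j<i. p j < t) \<and> conflict p i b t"
  obtain t1 where t1: "\<And>t. t \<ge> t1 \<Longrightarrow> seen b t ?y ?M" using eventually_seen[OF b] by blast
  obtain t2 where t2: "\<And>v t p. t \<ge> t2 v \<Longrightarrow> pre p (Suc ?i) = \<sigma> @ [v] \<Longrightarrow> ?Q p t"
    using assms(2) unfolding dead_def length_append_singleton by metis
  have "?Q p t"
    if t: "t \<ge> max (max t1 (Max (t2 ` {..?M}))) (Suc (max ?i (list_encode \<sigma>)))"
      and p: "pre p ?i = \<sigma>" for p t
  proof (cases "p ?i \<le> ?M")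
    case True
    have "t2 (p ?i) \<le> t" using True t by auto
    moreover have "pre p (Suc ?i) = \<sigma> @ [p ?i]" using p by (simp add: pre_def)
    ultimately show ?thesis by (rule t2)
  next
    case False
    have "seen b t (below_spike p ?i) ?M" using t1[of t] t p by (simp add: below_spike_def)
    then have "conflict p ?i b t" using False unfolding conflict_def by (meson le_SucI nat_le_linear)
    moreover have "p j < t" if "j < ?i" for j
    proof -
      have "p j \<in> set \<sigma>" using p that by (metis nth_mem nth_pre)
      then show ?thesis using less_list_encode[of "p j" \<sigma>] t by (simp add: Suc_le_eq)
    qed
    ultimately show ?thesis using t by (intro exI[of _ ?i]) (auto simp: Suc_le_eq)
  qed
  then show ?thesis unfolding dead_def by blast
qed

lemma ext_pre_eventually:
  assumes b: "clopen_rep b = Some g" and "modulus b y \<le> n"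
  shows "g (ext (pre y n)) = g y"
  using assms(2) by (intro clopen_locally_constant[OF b]) simp

text \<open>If \<open>p \<in> D\<close>, then \<open>g\<close> and \<open>test p\<close> differ at some point, and, both being locally constant, at an
  eventually zero point; a finite prefix of \<open>p\<close> determines the stage of \<open>p\<close> and the value of \<open>test p\<close> there.\<close>

lemma some_prefix_dead:
  assumes b: "clopen_rep b = Some g" and g: "\<And>p. (\<And>s. T p s) \<Longrightarrow> g \<noteq> test p"
  shows "\<exists>n. dead b (pre p n)"
proof (cases "\<forall>s. T p s")
  case False
  then obtain s where s: "\<not> T p s" by blast
  have "dead b (pre p (\<mu> s))"
  proof (rule dead_if_conflict)
    fix t p' assume "pre p' (length (pre p (\<mu> s))) = pre p (\<mu> s)"
    then have "T p' s = T p s" by (intro T_local) (auto dest: pre_eqD)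
    then show "conflict p' (length (pre p (\<mu> s))) b t"
      using s mu_ge[of s] by (auto simp: conflict_def)
  qed
  then show ?thesis ..
next
  case True
  obtain k where k: "stage p k" using ex_stage True by blast
  have test: "test p = spike p (Suc k)" by (rule stage_test[OF k])
  obtain y0 where "g y0 \<noteq> test p y0" using g True by blast
  then obtain ys where ys: "g (ext ys) \<noteq> spike p (Suc k) (ext ys)"
    using ext_pre_eventually[OF b, of y0] ext_pre_eventually[OF clopen_rep_spike_name, of p "Suc k" y0]
    unfolding test by (metis max.cobounded1 max.cobounded2)
  let ?y = "ext ys"
  obtain t0 where t0: "\<And>t. t \<ge> t0 \<Longrightarrow> seen b t ?y (modulus b ?y)"
    using eventually_seen[OF b] by blast
  \<comment> \<open>The first \<open>n\<close> entries of \<open>p\<close> determine that its stage is \<open>k\<close>, and the value of its test set at \<open>?y\<close>.\<close>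
  define n where "n = max (Max (\<mu> ` {..k})) (Suc (length (list_decode (?y 0))))"
  have mu_n: "\<forall>j\<le>k. \<mu> j \<le> n" by (simp add: n_def le_max_iff_disj)
  then have kn: "k \<le> n" using mu_ge[of k] by (meson order.refl order_trans)
  have "dead b (pre p n)"
  proof (rule dead_if_conflict[of "max t0 (Suc (max (list_encode ys) (modulus b ?y)))"])
    fix t p' assume t: "max t0 (Suc (max (list_encode ys) (modulus b ?y))) \<le> t"
      and "pre p' (length (pre p n)) = pre p n"
    then have eq: "p' i = p i" if "i < n" for i using that by (auto dest: pre_eqD)
    have "stage p' k" using k stage_cong[OF eq mu_n] by simp
    moreover have "spike p' (Suc k) ?y = spike p (Suc k) ?y"
      by (intro spike_cong eq) (simp add: n_def)
    then have "b (query_code 0 ?y (modulus b ?y)) \<noteq> Suc (spike p' (Suc k) ?y)"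
      using clopen_rep_modulus(1)[OF b, of ?y] ys by simp
    moreover have "length (list_decode (?y 0)) < n" by (simp add: n_def)
    ultimately have "conflict p' n b t"
      unfolding conflict_def using t t0[of t] kn mu_n
      by (intro disjI2 exI[of _ k] conjI exI[of _ "list_encode ys"] exI[of _ "modulus b ?y"]) auto
    then show "conflict p' (length (pre p n)) b t" by simp
  qed
  then show ?thesis ..
qed

text \<open>This is Koenig's lemma: every sequence that is not dead has a child that is not dead, so if
  the empty sequence were not dead, some point of Baire space would have no dead prefix.\<close>

lemma refuted_complete:
  assumes b: "clopen_rep b = Some g" and g: "\<And>p. (\<And>s. T p s) \<Longrightarrow> g \<noteq> test p"
  shows "\<exists>t. refuted b t"
proof -
  have "dead b []"
  proof (rule ccontr)
    assume "\<not> dead b []"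
    moreover have "\<exists>\<tau>. \<not> dead b \<tau> \<and> (\<exists>v. \<tau> = \<sigma> @ [v])" if "\<not> dead b \<sigma>" for \<sigma>
      using that dead_if_children_dead[OF b] by blast
    ultimately obtain f where f: "f 0 = []" "\<And>n. \<not> dead b (f n)" "\<And>n. \<exists>v. f (Suc n) = f n @ [v]"
      using dependent_nat_choice[of "\<lambda>n \<sigma>. \<not> dead b \<sigma> \<and> (n = 0 \<longrightarrow> \<sigma> = [])" "\<lambda>_ \<sigma> \<tau>. \<exists>v. \<tau> = \<sigma> @ [v]"]
      by (metis old.nat.distinct(2))
    define p where "p n = last (f (Suc n))" for n
    have "pre p n = f n" for n
    proof (induction n)
      case (Suc n)
      then show ?case using f(3)[of n] by (auto simp: pre_def p_def)
    qed (simp add: pre_def f(1))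
    then show False using some_prefix_dead[OF b g] f(2) by metis
  qed
  then obtain t0 where "\<And>p. \<exists>i<t0. (\<forall>j<i. p j < t0) \<and> conflict p i b t0"
    unfolding dead_def by (metis length_pre list.size(3) length_0_conv order_refl)
  then have "refuted b t0" unfolding refuted_def by blast
  then show ?thesis ..
qed

text \<open>The answer at output position \<open>n\<close> is given when \<open>n\<close> entries of the name are known, and it is
  nonzero (code \<open>2\<close>) iff these refute all test sets.\<close>

definition diag_name :: baire where
  "diag_name z = (let l = list_decode z; n = ext l 0 in
    if length l = Suc n then if refuted (ext (tl l)) n then 2 else 1 else 0)"

definition diag_open :: "(baire \<Rightarrow> nat) \<Rightarrow> bool" where
  "diag_open = restrict (\<lambda>g. \<forall>p. (\<forall>s. T p s) \<longrightarrow> g \<noteq> test p) (ran clopen_rep)"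

lemma conflict_cong:
  assumes "\<And>z. z < t \<Longrightarrow> b z = b' z"
  shows "conflict p i b t = conflict p i b' t"
proof -
  have seen: "seen b t y m = seen b' t y m" for y m
    using assms by (rule seen_cong)
  have "seen b' t y m \<and> b (query_code 0 y m) \<noteq> v \<longleftrightarrow>
      seen b' t y m \<and> b' (query_code 0 y m) \<noteq> v" for y m v
    using assms by (auto simp: seen_def)
  then show ?thesis by (simp only: conflict_def seen)
qed

lemma refuted_cong:
  assumes "\<And>z. z < t \<Longrightarrow> b z = b' z"
  shows "refuted b t = refuted b' t"
  unfolding refuted_def using conflict_cong[OF assms] by simp

lemma diag_name_query_code:
  "diag_name (query_code n b k) = (if k = n then if refuted b n then 2 else 1 else 0)"
proof -
  have "refuted (ext (pre b n)) n = refuted b n" by (rule refuted_cong) simp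
  then show ?thesis by (simp add: diag_name_def query_code_eq ext_Cons)
qed

lemma opens_rep_diag: "opens_rep clopen_rep diag_name = Some diag_open"
proof (rule opens_repI)
  show "diag_open \<in> extensional (ran clopen_rep)" by (simp add: diag_open_def)
  show "\<exists>k. diag_name (query_code n b k) \<noteq> 0" for n b by (simp add: diag_name_query_code)
  fix b g assume b: "clopen_rep b = Some g"
  have "accepts diag_name b \<longleftrightarrow> (\<exists>n. refuted b n)"
    by (auto simp: accepts_def diag_name_query_code split: if_splits)
  also have "\<dots> \<longleftrightarrow> (\<forall>p. (\<forall>s. T p s) \<longrightarrow> g \<noteq> test p)"
    using refuted_sound[OF _ b] refuted_complete[OF b] by blast
  finally show "diag_open g \<longleftrightarrow> accepts diag_name b"
    using b by (auto simp: diag_open_def ran_def)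
qed

lemma zero_in_diag_open: "diag_open (\<lambda>_. 0)"
proof -
  have "(\<lambda>_. 0) \<in> ran clopen_rep" using clopen_rep_zero unfolding ran_def by blast
  then show ?thesis unfolding diag_open_def test_def using spike_nonzero by (simp add: eq_commute)
qed

text \<open>All quantifiers in the definition are bounded. The name of \<open>0\<close> that is used in \<^const>\<open>stage\<close> is
  replaced by its relevant prefix, as acceptance is only assumed to be computable on finite sequences.\<close>

lemma computable_diag_name:
  assumes mu: "computable \<mu>" and T: "computable (\<lambda>z. T (ext (fst z)) (snd z))"
    and acc: "computable (\<lambda>z. acc (ext (fst z)) (ext (fst (snd z))) (snd (snd z)))"
  shows "computable diag_name"
proof -
  have acc_list: "acc p (spike_name p 0) k = acc p (ext (pre (spike_name p 0) k)) k" for p k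
    by (rule acc_local) auto
  \<comment> \<open>These rules are used at several argument types, because the binders around them extend the
    argument.\<close>
  have qc: "computable (\<lambda>x. query_code (n x) (y x) (k x))"
    if "computable n" "computable (\<lambda>z. y (fst z) (snd z))" "computable k"
    for n k and y :: "'a :: coded \<Rightarrow> baire"
    unfolding query_code_eq by (intro computable_intros that computable_comp2[OF that(2)])
  have seen: "computable (\<lambda>x. seen (ext (b x)) (t x) (y x) (m x))"
    if "computable b" "computable t" "computable (\<lambda>z. y (fst z) (snd z))" "computable m"
    for b t m and y :: "'a :: coded \<Rightarrow> baire"
    unfolding seen_def
    by (intro computable_intros qc that computable_comp2[OF that(3)] computable_comp[OF that(1) computable_fst]
      computable_comp[OF that(2) computable_fst])
  have conf: "computable (\<lambda>x. conflict (ext (p x)) (i x) (ext (b x)) (t x))"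
    if "computable p" "computable i" "computable b" "computable t"
    for p i b and t :: "'a :: coded \<Rightarrow> nat"
    unfolding conflict_def stage_def acc_list below_spike_def
    by (intro computable_intros qc seen that that[THEN computable_comp] computable_comp[OF mu]
       computable_comp2[OF T] computable_comp3[OF acc])
  show ?thesis
    unfolding diag_name_def refuted_def Let_def replicate_bound_def
    by (intro computable_intros conf)
qed

end

text \<open>The construction above needs every point of \<open>D\<close> to accept \<open>0\<close>. To this end a point \<open>p\<close> is preceded by a
  stage \<open>s\<close> at which the constant name of \<open>0\<close> is accepted. That this is so is decidable, hence
  these sequences form a closed set again.\<close>

theorem ex_diagonal_open:
  fixes \<mu> :: "nat \<Rightarrow> nat" and T :: "baire \<Rightarrow> nat \<Rightarrow> bool" and acc :: "baire \<Rightarrow> baire \<Rightarrow> nat \<Rightarrow> bool"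
    and V :: "baire \<Rightarrow> (baire \<Rightarrow> nat) \<Rightarrow> bool"
  assumes mu_ge: "\<And>s. s \<le> \<mu> s"
    and mono: "mono \<mu>"
    and T_local: "\<And>p p' s. (\<And>i. i < \<mu> s \<Longrightarrow> p i = p' i) \<Longrightarrow> T p s = T p' s"
    and acc_local: "\<And>p p' b b' s. (\<And>i. i < \<mu> s \<Longrightarrow> p i = p' i) \<Longrightarrow> (\<And>z. z < s \<Longrightarrow> b z = b' z) \<Longrightarrow>
      acc p b s = acc p' b' s"
    and V: "\<And>p b x. \<forall>s. T p s \<Longrightarrow> clopen_rep b = Some x \<Longrightarrow> V p x \<longleftrightarrow> (\<exists>s. acc p b s)"
  obtains u U where "opens_rep clopen_rep u = Some U" "U (\<lambda>_. 0)"
    and "\<And>p. \<forall>s. T p s \<Longrightarrow> V p (\<lambda>_. 0) \<Longrightarrow> \<exists>x\<in>ran clopen_rep. V p x \<and> \<not> U x"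
    and "computable \<mu> \<Longrightarrow> computable (\<lambda>z. T (ext (fst z)) (snd z)) \<Longrightarrow>
      computable (\<lambda>z. acc (ext (fst z)) (ext (fst (snd z))) (snd (snd z))) \<Longrightarrow> computable_point u"
proof -
  define sh :: "baire \<Rightarrow> baire" where "sh p = (\<lambda>i. p (Suc i))" for p
  define \<mu>' where "\<mu>' s = Suc (\<mu> s)" for s
  \<comment> \<open>The guard delays the check of the stage \<open>p 0\<close> until \<open>s\<close> is large enough for \<open>\<mu> s\<close> to cover the
    part of \<open>p\<close> that it reads.\<close>
  define T' where "T' p s \<longleftrightarrow> T (sh p) s \<and> (p 0 \<le> s \<longrightarrow> acc (sh p) (\<lambda>_. 1) (p 0))" for p s
  define acc' where "acc' p b s \<longleftrightarrow> acc (sh p) b s" for p b s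
  have D: "\<forall>s. T (sh p) s" "acc (sh p) (\<lambda>_. 1) (p 0)" if "\<And>s. T' p s" for p
    using that unfolding T'_def by blast+
  interpret d: diagonalisation \<mu>' "T'" acc'
  proof
    show "s \<le> \<mu>' s" for s using mu_ge[of s] by (simp add: \<mu>'_def)
  next
    fix s and p p' :: baire
    assume eq: "\<And>i. i < \<mu>' s \<Longrightarrow> p i = p' i"
    have "acc (sh p) (\<lambda>_. 1) (p 0) = acc (sh p') (\<lambda>_. 1) (p 0)" if "p 0 \<le> s"
      using eq monoD[OF mono that] by (intro acc_local) (auto simp: \<mu>'_def sh_def)
    moreover have "p 0 = p' 0" using eq[of 0] by (simp add: \<mu>'_def)
    moreover have "T (sh p) s = T (sh p') s"
      using eq by (intro T_local) (simp add: \<mu>'_def sh_def)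
    ultimately show "T' p s = T' p' s" unfolding T'_def by auto
  next
    fix s and p p' b b' :: baire
    assume eq: "\<And>i. i < \<mu>' s \<Longrightarrow> p i = p' i" and b: "\<And>z. z < s \<Longrightarrow> b z = b' z"
    show "acc' p b s = acc' p' b' s"
      unfolding acc'_def using eq b by (intro acc_local) (auto simp: \<mu>'_def sh_def)
  next
    fix p a assume T': "\<And>s. T' p s" and a: "clopen_rep a = Some (\<lambda>_. 0)"
    show "\<exists>s. acc' p a s"
      unfolding acc'_def using V[OF D(1)[OF T']] D(2)[OF T'] clopen_rep_zero a by blast
  qed
  show thesis
  proof (rule that[OF d.opens_rep_diag d.zero_in_diag_open])
    fix p assume T: "\<forall>s. T p s" and "V p (\<lambda>_. 0)"
    then obtain s where s: "acc p (\<lambda>_. 1) s" using V clopen_rep_zero by blast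
    define p' where "p' = case_nat s p"
    have sh: "sh p' = p" "p' 0 = s" by (simp_all add: sh_def p'_def)
    then have T': "T' p' r" for r using T s by (simp add: T'_def)
    obtain b k where b: "clopen_rep b = Some (d.test p')" "acc p b k"
      using d.test_accepted[OF T'] sh by (auto simp: acc'_def)
    have "\<not> d.diag_open (d.test p')"
      using T' b(1) by (auto simp: d.diag_open_def ran_def)
    then show "\<exists>x\<in>ran clopen_rep. V p x \<and> \<not> d.diag_open x"
      using b V[OF T] by (metis ranI)
  next
    assume mu: "computable \<mu>" and T: "computable (\<lambda>z. T (ext (fst z)) (snd z))"
      and acc: "computable (\<lambda>z. acc (ext (fst z)) (ext (fst (snd z))) (snd (snd z)))"
    have sh: "sh (ext xs) = ext (tl xs)" for xs
      by (cases xs) (auto simp: sh_def ext_def fun_eq_iff)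
    have one: "acc p (\<lambda>_. 1) k = acc p (ext (pre (\<lambda>_. 1) k)) k" for p k
      by (rule acc_local) auto
    show "computable_point d.diag_name"
    proof (intro computable_point_if_computable d.computable_diag_name)
      show "computable \<mu>'" unfolding \<mu>'_def by (intro computable_intros mu)
      show "computable (\<lambda>z. T' (ext (fst z)) (snd z))"
        unfolding T'_def sh one
        by (intro computable_intros computable_comp2[OF T] computable_comp3[OF acc])
      show "computable (\<lambda>z. acc' (ext (fst z)) (ext (fst (snd z))) (snd (snd z)))"
        unfolding acc'_def sh by (intro computable_intros computable_comp3[OF acc])
    qed
  qed
qed

section \<open>Open sets of Baire space and continuity\<close>

lemma open_baire_iff:
  fixes A :: "baire set"
  shows "open A \<longleftrightarrow> (\<forall>p\<in>A. \<exists>s. \<forall>p'. (\<forall>i<s. p' i = p i) \<longrightarrow> p' \<in> A)"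
proof
  assume "open A"
  show "\<forall>p\<in>A. \<exists>s. \<forall>p'. (\<forall>i<s. p' i = p i) \<longrightarrow> p' \<in> A"
  proof
    fix p assume "p \<in> A"
    then obtain X where X: "p \<in> Pi\<^sub>E UNIV X" "finite {i. X i \<noteq> UNIV}" "Pi\<^sub>E UNIV X \<subseteq> A"
      using product_topology_open_contains_basis[of "\<lambda>_. euclidean" UNIV A p] \<open>open A\<close>
      by (auto simp: open_fun_def)
    then obtain s where s: "\<And>i. X i \<noteq> UNIV \<Longrightarrow> i < s"
      using finite_nat_set_iff_bounded by auto
    have "p' \<in> A" if "\<forall>i<s. p' i = p i" for p'
    proof -
      have "p' i \<in> X i" for i using that s[of i] X(1) by (cases "X i = UNIV") auto
      then show ?thesis using X(3) by auto
    qed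
    then show "\<exists>s. \<forall>p'. (\<forall>i<s. p' i = p i) \<longrightarrow> p' \<in> A" by blast
  qed
next
  assume loc: "\<forall>p\<in>A. \<exists>s. \<forall>p'. (\<forall>i<s. p' i = p i) \<longrightarrow> p' \<in> A"
  have cyl: "open {p'. \<forall>i<s. p' i = p i}" for s and p :: baire
  proof -
    have "open (Pi\<^sub>E UNIV (\<lambda>i. if i < s then {p i} else UNIV))"
      by (rule open_PiE) (auto intro: finite_subset[of _ "{..<s}"] simp: open_discrete split: if_splits)
    moreover have "Pi\<^sub>E UNIV (\<lambda>i. if i < s then {p i} else UNIV) = {p'. \<forall>i<s. p' i = p i}"
      by (auto simp: PiE_iff split: if_splits)
    ultimately show ?thesis by simp
  qed
  have "\<exists>B. open B \<and> p \<in> B \<and> B \<subseteq> A" if p: "p \<in> A" for p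
  proof -
    obtain s where s: "\<forall>p'. (\<forall>i<s. p' i = p i) \<longrightarrow> p' \<in> A"
      using bspec[OF loc p] by (rule exE)
    show ?thesis
      by (rule exI[of _ "{p'. \<forall>i<s. p' i = p i}"]) (use cyl s in auto)
  qed
  then show "open A" unfolding open_subopen[of A] by simp
qed

lemma continuous_on_baire_local:
  fixes F :: "baire \<Rightarrow> baire"
  assumes "continuous_on UNIV F"
  shows "\<exists>s. \<forall>p'. (\<forall>i<s. p' i = p i) \<longrightarrow> (\<forall>z<m. F p' z = F p z)"
proof -
  have "open (F -` {q. \<forall>i<m. q i = F p i})"
    using assms by (intro open_vimage) (auto simp: open_baire_iff intro!: exI[of _ m])
  then show ?thesis unfolding open_baire_iff by force
qed

lemma openin_set_of_open:
  assumes "opens_rep X u = Some U"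
  shows "openin (rep_topology X) (set_of_open X U)"
proof -
  have "\<exists>s. \<forall>b'. (\<forall>i<s. b' i = b i) \<longrightarrow> accepts u b'" if acc: "accepts u b" for b
  proof -
    obtain n k where nk: "2 \<le> u (query_code n b k)" "\<forall>j<k. u (query_code n b j) = 0"
      using acc unfolding accepts_def by blast
    have "accepts u b'" if "\<forall>i<k. b' i = b i" for b'
    proof -
      have "query_code n b' j = query_code n b j" if "j \<le> k" for j
        using that \<open>\<forall>i<k. b' i = b i\<close> by (intro query_code_cong) auto
      then show ?thesis using nk unfolding accepts_def by (metis less_imp_le order_refl)
    qed
    then show ?thesis by blast
  qed
  then have "open {b. accepts u b}" by (simp add: open_baire_iff)
  moreover have "{b \<in> dom X. the (X b) \<in> set_of_open X U} = dom X \<inter> {b. accepts u b}"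
    using opens_rep_accepts[OF assms] by (auto simp: set_of_open_def ran_def)
  ultimately show ?thesis
    unfolding openin_rep_topology by (auto simp: set_of_open_def)
qed

text \<open>A basis contains some \<open>f p\<close> with \<open>0 \<in> f p \<subseteq> U\<close> for the diagonal open set \<open>U\<close>, a
  contradiction. Acceptance at stage \<open>s\<close> means that the realizer gives a positive answer on all points with
  the same first \<open>s\<close> entries.\<close>

theorem not_baire_based: "\<not> baire_based clopen_rep"
proof
  assume "baire_based clopen_rep"
  then obtain f where f: "continuous_rep rep_baire (opens_rep clopen_rep) f"
    and basis: "topology_basis (rep_topology clopen_rep) (set_of_open clopen_rep ` range f)"
    unfolding baire_based_def by blast
  obtain F where F: "continuous_on UNIV F" "\<And>p. opens_rep clopen_rep (F p) = Some (f p)"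
    using f unfolding continuous_rep_def realizer_def by (auto simp: rep_baire_def dom_def)
  define acc where "acc p b s \<longleftrightarrow> (\<forall>p'. (\<forall>i<s. p' i = p i) \<longrightarrow> (\<exists>n<s. \<exists>k<s.
    2 \<le> F p' (query_code n b k) \<and> (\<forall>j<k. F p' (query_code n b j) = 0)))" for p b s
  have V: "f p x \<longleftrightarrow> (\<exists>s. acc p b s)" if b: "clopen_rep b = Some x" for p b x
    unfolding opens_rep_accepts[of clopen_rep, OF F(2)[of p] b]
  proof
    assume "accepts (F p) b"
    then obtain n k where nk: "2 \<le> F p (query_code n b k)" "\<forall>j<k. F p (query_code n b j) = 0"
      unfolding accepts_def by blast
    define m where "m = Suc (Max (query_code n b ` {..k}))"
    have m: "query_code n b j < m" if "j \<le> k" for j using that by (simp add: m_def less_Suc_eq_le)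
    obtain s where s: "\<And>p'. \<forall>i<s. p' i = p i \<Longrightarrow> \<forall>z<m. F p' z = F p z"
      using continuous_on_baire_local[OF F(1), of p m] by blast
    have "acc p b (max s (Suc (max n k)))"
      unfolding acc_def
    proof (intro allI impI)
      fix p' assume "\<forall>i<max s (Suc (max n k)). p' i = p i"
      then have "F p' (query_code n b j) = F p (query_code n b j)" if "j \<le> k" for j
        using s[of p'] m[OF that] by simp
      then show "\<exists>n'<max s (Suc (max n k)). \<exists>k'<max s (Suc (max n k)).
          2 \<le> F p' (query_code n' b k') \<and> (\<forall>j<k'. F p' (query_code n' b j) = 0)"
        using nk by (intro exI[of _ n] conjI exI[of _ k]) auto
    qed
    then show "\<exists>s. acc p b s" ..
  next
    assume "\<exists>s. acc p b s"
    then show "accepts (F p) b" unfolding acc_def accepts_def by blast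
  qed
  obtain u U where u: "opens_rep clopen_rep u = Some U" and zero: "U (\<lambda>_. 0)"
    and diag: "\<And>p. f p (\<lambda>_. 0) \<Longrightarrow> \<exists>x\<in>ran clopen_rep. f p x \<and> \<not> U x"
  proof (rule ex_diagonal_open[of "\<lambda>s. s" "\<lambda>_ _. True" acc f])
    show "acc p b s = acc p' b' s"
      if "\<And>i. i < s \<Longrightarrow> p i = p' i" "\<And>z. z < s \<Longrightarrow> b z = b' z" for p p' b b' s
    proof -
      have "2 \<le> F r (query_code n b k) \<and> (\<forall>j<k. F r (query_code n b j) = 0) \<longleftrightarrow>
          2 \<le> F r (query_code n b' k) \<and> (\<forall>j<k. F r (query_code n b' j) = 0)" if "k < s" for r n k
      proof -
        have "query_code n b j = query_code n b' j" if "j \<le> k" for j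
          using that \<open>k < s\<close> \<open>\<And>z. z < s \<Longrightarrow> b z = b' z\<close> by (intro query_code_cong) auto
        then show ?thesis by simp
      qed
      then show ?thesis unfolding acc_def using that(1) by (simp cong: conj_cong)
    qed
  qed (use V in \<open>auto simp: mono_def\<close>)
  have ran: "(\<lambda>_. 0) \<in> ran clopen_rep" using ranI[of clopen_rep, OF clopen_rep_zero] by simp
  have "\<exists>B\<subseteq>set_of_open clopen_rep ` range f. \<Union>B = set_of_open clopen_rep U"
    by (rule mp[OF spec[OF conjunct2[OF basis[unfolded topology_basis_def]]] openin_set_of_open[OF u]])
  then obtain B where B: "B \<subseteq> set_of_open clopen_rep ` range f" "\<Union>B = set_of_open clopen_rep U"
    by (elim exE conjE)
  have "(\<lambda>_. 0) \<in> \<Union>B" using zero ran by (simp add: B(2) set_of_open_def)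
  then obtain W where W: "W \<in> B" "(\<lambda>_. 0) \<in> W" by (rule UnionE)
  then obtain p where p: "W = set_of_open clopen_rep (f p)" using subsetD[OF B(1) W(1)] by (elim imageE) simp
  have "W \<subseteq> set_of_open clopen_rep U" using Union_upper[OF W(1)] B(2) by simp
  then show False using diag[of p] W(2) by (auto simp: p set_of_open_def)
qed

section \<open>Effective enumerations of open sets\<close>

text \<open>\<^const>\<open>accepts\<close> for the name that the program \<open>e\<close> computes, approximated by computations with resources \<open>s\<close>. As
  \<^const>\<open>run\<close> adds one to a value, \<open>3\<close> and \<open>1\<close> stand for the answers \<open>2\<close> and \<open>0\<close>.\<close>

definition accepting_run :: "recf \<Rightarrow> baire \<Rightarrow> baire \<Rightarrow> nat \<Rightarrow> bool" where
  "accepting_run e q b s \<longleftrightarrow> (\<exists>n<s. \<exists>k<s. 3 \<le> run s q e [query_code n b k] \<and>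
    (\<forall>j<k. run s q e [query_code n b j] = 1))"

lemma accepting_run_iff_accepts:
  assumes u: "\<And>z. recf_eval q e [z] (u z)"
  shows "(\<exists>s. accepting_run e q b s) \<longleftrightarrow> accepts u b"
proof
  assume "\<exists>s. accepting_run e q b s"
  then obtain s n k where k: "3 \<le> run s q e [query_code n b k]"
    "\<forall>j<k. run s q e [query_code n b j] = 1"
    by (auto simp: accepting_run_def)
  have run: "u z = run s q e [z] - 1" if "run s q e [z] \<noteq> 0" for z
    using recf_eval_functional[OF u run_sound[of s q e "[z]" "run s q e [z] - 1"]] that by simp
  have "2 \<le> u (query_code n b k)" using run[of "query_code n b k"] k(1) by simp
  moreover have "u (query_code n b j) = 0" if "j < k" for j
    using run[of "query_code n b j"] k(2) that by simp
  ultimately show "accepts u b" unfolding accepts_def by blast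
next
  assume "accepts u b"
  then obtain n k where k: "2 \<le> u (query_code n b k)" "\<forall>j<k. u (query_code n b j) = 0"
    by (auto simp: accepts_def)
  obtain t where t: "\<And>z t'. t z \<le> t' \<Longrightarrow> run t' q e [z] = Suc (u z)"
    using run_complete[OF u] by metis
  let ?s = "Max (insert (Suc n) (insert (Suc k) ((\<lambda>j. t (query_code n b j)) ` {..k})))"
  have "n < ?s" "k < ?s" by (simp_all add: less_eq_Suc_le)
  moreover have "run ?s q e [query_code n b j] = Suc (u (query_code n b j))" if "j \<le> k" for j
    using that by (intro t Max_ge) auto
  ultimately have "accepting_run e q b ?s"
    unfolding accepting_run_def using k by (intro exI[of _ n] conjI exI[of _ k]) auto
  then show "\<exists>s. accepting_run e q b s" ..
qed

lemma accepting_run_cong: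
  assumes "\<And>i. i < s \<Longrightarrow> q i = q' i" "\<And>z. z < s \<Longrightarrow> b z = b' z"
  shows "accepting_run e q b s = accepting_run e q' b' s"
proof -
  have "3 \<le> run s q' e [query_code n b k] \<and> (\<forall>j<k. run s q' e [query_code n b j] = 1) \<longleftrightarrow>
      3 \<le> run s q' e [query_code n b' k] \<and> (\<forall>j<k. run s q' e [query_code n b' j] = 1)"
    if "k < s" for n k
  proof -
    have "query_code n b j = query_code n b' j" if "j \<le> k" for j
      using that \<open>k < s\<close> assms(2) by (intro query_code_cong) auto
    then show ?thesis by simp
  qed
  moreover have "run s q e xs = run s q' e xs" for xs
    using assms(1) by (rule run_cong)
  ultimately show ?thesis unfolding accepting_run_def by (simp cong: conj_cong)
qed

lemma computable_accepting_run [computable_intros]: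
  assumes q: "computable (\<lambda>z. q (fst z) (snd z))" and b: "computable (\<lambda>z. b (fst z) (snd z))"
    and s: "computable s"
  shows "computable (\<lambda>x. accepting_run e (q x) (b x) (s x))"
  unfolding accepting_run_def query_code_eq
  by (intro computable_intros computable_comp2[OF q] computable_comp2[OF b] s
    computable_comp[OF s computable_fst])

lemma computable_point_in_opens:
  "opens_rep X u = Some U \<Longrightarrow> computable_point u \<Longrightarrow> U \<in> computable_points (opens_rep X)"
  unfolding computable_points_def by blast

text \<open>\<open>D\<close> consists of all \<open>p\<close> for which \<open>p(1), p(2), \<dots>\<close> is a witness of \<open>p(0) \<in> S\<close>. Since the
  enumeration need only be defined on \<open>S\<close>, its program is run on \<open>p\<close> itself, which is a name of \<open>p(0)\<close>.\<close>

theorem not_Sigma11_enumerable: "\<not> computable_opens_Sigma11_enumerable clopen_rep"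
proof
  assume "computable_opens_Sigma11_enumerable clopen_rep"
  then obtain S f F where "Sigma11 S" and F: "computable_on (dom (subspace_rep rep_nat S)) F"
      "realizer (subspace_rep rep_nat S) (opens_rep clopen_rep) F f"
    and onto: "f ` S = computable_points (opens_rep clopen_rep)"
    unfolding computable_opens_Sigma11_enumerable_def computable_rep_def by blast
  obtain d where S: "S = {n. \<exists>x. \<not> (\<exists>y. recf_eval x d [n] y)}"
    using \<open>Sigma11 S\<close> unfolding Sigma11_def Pi01_def by blast
  have dom: "subspace_rep rep_nat S p = Some (p 0)" if "p 0 \<in> S" for p
    using that by (simp add: subspace_rep_def rep_nat_def)
  obtain e where e: "\<And>p z. p 0 \<in> S \<Longrightarrow> recf_eval p e [z] (F p z)"
    using F(1) dom unfolding computable_on_def by blast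
  have Fp: "opens_rep clopen_rep (F p) = Some (f (p 0))" if "p 0 \<in> S" for p :: baire
    using F(2) dom[of p] that unfolding realizer_def by blast
  define T where "T p s \<longleftrightarrow> run s (\<lambda>i. p (Suc i)) d [p 0] = 0" for p s
  have T: "(\<forall>s. T p s) \<longleftrightarrow> \<not> (\<exists>y. recf_eval (\<lambda>i. p (Suc i)) d [p 0] y)" for p
    unfolding T_def using run_sound run_complete by (metis not0_implies_Suc nat.distinct(1) order_refl)
  then have TS: "p 0 \<in> S" if "\<forall>s. T p s" for p using that S by blast
  obtain u U where u: "opens_rep clopen_rep u = Some U" and zero: "U (\<lambda>_. 0)"
    and diag: "\<And>p. \<forall>s. T p s \<Longrightarrow> f (p 0) (\<lambda>_. 0) \<Longrightarrow> \<exists>x\<in>ran clopen_rep. f (p 0) x \<and> \<not> U x"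
    and comp: "computable (Suc) \<Longrightarrow> computable (\<lambda>z. T (ext (fst z)) (snd z)) \<Longrightarrow>
      computable (\<lambda>z. accepting_run e (ext (fst z)) (ext (fst (snd z))) (snd (snd z))) \<Longrightarrow>
      computable_point u"
  proof (rule ex_diagonal_open[of Suc T "accepting_run e" "\<lambda>p. f (p 0)"])
    show "T p s = T p' s" if "\<And>i. i < Suc s \<Longrightarrow> p i = p' i" for p p' s
      using that run_cong[of s "\<lambda>i. p (Suc i)" "\<lambda>i. p' (Suc i)"] by (simp add: T_def)
    show "accepting_run e p b s = accepting_run e p' b' s"
      if "\<And>i. i < Suc s \<Longrightarrow> p i = p' i" "\<And>z. z < s \<Longrightarrow> b z = b' z" for p p' b b' s
      using that by (intro accepting_run_cong) auto
    show "f (p 0) x \<longleftrightarrow> (\<exists>s. accepting_run e p b s)"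
      if "\<forall>s. T p s" "clopen_rep b = Some x" for p b x
    proof -
      have p: "p 0 \<in> S" using that(1) by (rule TS)
      show ?thesis
        using opens_rep_accepts[of clopen_rep, OF Fp[of p, OF p] that(2)]
          accepting_run_iff_accepts[of p e "F p", OF e[of p, OF p]] by simp
    qed
  qed (auto simp: mono_def)
  have "computable_point u"
  proof (rule comp)
    show "computable Suc" using computable_Suc[OF computable_id] by simp
    show "computable (\<lambda>z. T (ext (fst z)) (snd z))" unfolding T_def by (intro computable_intros)
    show "computable (\<lambda>z. accepting_run e (ext (fst z)) (ext (fst (snd z))) (snd (snd z)))"
      by (intro computable_intros)
  qed
  then obtain n where n: "n \<in> S" "U = f n"
    using computable_point_in_opens[OF u] onto by blast
  then obtain x where "\<not> (\<exists>y. recf_eval x d [n] y)" using S by blast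
  then have "\<forall>s. T (case_nat n x) s" unfolding T by simp
  then show False using diag[of "case_nat n x"] zero n by simp
qed

text \<open>For \<open>p \<in> D\<close>, the sequence \<open>p\<close> codes an index \<open>p(0)\<close>, the characteristic function of \<open>A\<close> (the entries paired with
  \<open>0\<close>) and for every \<open>k\<close> a witness of \<open>k \<in> A\<close> or of \<open>k \<notin> A\<close> (the other entries). The witnesses make the
  oracle unique, so on \<open>D\<close> the enumeration relative to \<open>A\<close> is a computable function of \<open>p\<close>.\<close>

theorem not_enumerable_rel_Delta11:
  assumes "Delta11 A"
  shows "\<not> computable_opens_enumerable_rel A clopen_rep"
proof
  assume "computable_opens_enumerable_rel A clopen_rep"
  then obtain f F where F: "computable_on_rel A UNIV F" "realizer rep_nat (opens_rep clopen_rep) F f"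
    and onto: "computable_points (opens_rep clopen_rep) \<subseteq> range f"
    unfolding computable_opens_enumerable_rel_def computable_rep_rel_def
    by (auto simp: rep_nat_def dom_def)
  obtain d where A: "A = {n. \<exists>x. \<not> (\<exists>y. recf_eval x d [n] y)}"
    using assms unfolding Delta11_def Sigma11_def Pi01_def by blast
  obtain d' where A': "- A = {n. \<exists>x. \<not> (\<exists>y. recf_eval x d' [n] y)}"
    using assms unfolding Delta11_def Sigma11_def Pi01_def by blast
  obtain e where e: "\<And>n z. recf_eval (join (\<lambda>k. of_bool (k \<in> A)) (\<lambda>_. n)) e [z] (F (\<lambda>_. n) z)"
    using F(1) unfolding computable_on_rel_def by blast
  have Fn: "opens_rep clopen_rep (F (\<lambda>_. n)) = Some (f n)" for n
    using F(2) unfolding realizer_def rep_nat_def by blast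
  \<comment> \<open>Stage \<open>s\<close> reads no entry beyond the one paired as \<open>(s, s)\<close>; one \<open>Suc\<close> makes room for the index
    \<open>p 0\<close>, the other turns the last position into a strict bound.\<close>
  define \<mu> where "\<mu> s = Suc (Suc (prod_encode (s, s)))" for s
  define mem where "mem p k \<longleftrightarrow> p (Suc (prod_encode (k, 0))) \<noteq> 0" for p :: baire and k
  define wit where "wit p k j = p (Suc (prod_encode (k, Suc j)))" for p :: baire and k j
  define q where "q p = join (\<lambda>k. of_bool (mem p k)) (\<lambda>_. p 0)" for p
  define T where "T p s \<longleftrightarrow> (\<forall>k<s. if mem p k then run s (wit p k) d [k] = 0
    else run s (wit p k) d' [k] = 0)" for p s
  have mu: "Suc (prod_encode (k, j)) < \<mu> s" if "k \<le> s" "j \<le> s" for k j s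
    using prod_encode_mono[OF that] by (simp add: \<mu>_def)
  have halt: "\<exists>t. \<forall>s\<ge>t. run s x c [k] \<noteq> 0" if "recf_eval x c [k] y" for x c k y
    using run_complete[OF that] by (metis nat.distinct(1))
  have mem: "mem p k \<longleftrightarrow> k \<in> A" if T: "\<forall>s. T p s" for p k
  proof -
    have "\<not> recf_eval (wit p k) (if mem p k then d else d') [k] y" for y
    proof
      assume "recf_eval (wit p k) (if mem p k then d else d') [k] y"
      from halt[OF this] obtain t where
        "\<And>s. s \<ge> t \<Longrightarrow> run s (wit p k) (if mem p k then d else d') [k] \<noteq> 0" by blast
      from this[of "max t (Suc k)"] show False
        using spec[OF T, of "max t (Suc k)"] unfolding T_def by (auto split: if_splits)
    qed
    note no_halt = this
    have "k \<in> A" if "mem p k" unfolding A using no_halt that by (simp, blast)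
    moreover have "k \<in> - A" if "\<not> mem p k" unfolding A' using no_halt that by (simp, blast)
    ultimately show ?thesis by blast
  qed
  have q: "q p = join (\<lambda>k. of_bool (k \<in> A)) (\<lambda>_. p 0)" if T: "\<forall>s. T p s" for p
    using mem[OF T] by (simp add: q_def)
  obtain u U where u: "opens_rep clopen_rep u = Some U" and zero: "U (\<lambda>_. 0)"
    and diag: "\<And>p. \<forall>s. T p s \<Longrightarrow> f (p 0) (\<lambda>_. 0) \<Longrightarrow> \<exists>x\<in>ran clopen_rep. f (p 0) x \<and> \<not> U x"
    and comp: "computable \<mu> \<Longrightarrow> computable (\<lambda>z. T (ext (fst z)) (snd z)) \<Longrightarrow>
      computable (\<lambda>z. accepting_run e (q (ext (fst z))) (ext (fst (snd z))) (snd (snd z))) \<Longrightarrow>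
      computable_point u"
  proof (rule ex_diagonal_open[of \<mu> T "\<lambda>p. accepting_run e (q p)" "\<lambda>p. f (p 0)"])
    show "s \<le> \<mu> s" for s using le_prod_encode_1[of s s] by (simp add: \<mu>_def)
    show "mono \<mu>" by (rule monoI) (simp add: \<mu>_def prod_encode_mono)
    have mem_cong: "mem p k = mem p' k" if "\<And>i. i < \<mu> s \<Longrightarrow> p i = p' i" "k \<le> s" for p p' k s
      using that mu[of k s 0] by (simp add: mem_def)
    show "T p s = T p' s" if eq: "\<And>i. i < \<mu> s \<Longrightarrow> p i = p' i" for p p' s
    proof -
      have "run s (wit p k) c xs = run s (wit p' k) c xs" if "k < s" for k c xs
        using that mu[of k s "Suc _"] by (intro run_cong) (auto simp: wit_def intro!: eq)
      then show ?thesis using mem_cong[OF eq] by (simp add: T_def)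
    qed
    show "accepting_run e (q p) b s = accepting_run e (q p') b' s"
      if eq: "\<And>i. i < \<mu> s \<Longrightarrow> p i = p' i" and "\<And>z. z < s \<Longrightarrow> b z = b' z" for p p' b b' s
    proof (rule accepting_run_cong)
      show "q p i = q p' i" if "i < s" for i
      proof -
        have "mem p (i div 2) = mem p' (i div 2)"
          by (rule mem_cong[where s = s]) (use eq that in auto)
        then show ?thesis using eq[of 0] by (simp add: q_def join_def \<mu>_def)
      qed
    qed (rule that(2))
    show "f (p 0) x \<longleftrightarrow> (\<exists>s. accepting_run e (q p) b s)"
      if T: "\<forall>s. T p s" and b: "clopen_rep b = Some x" for p b x
      using opens_rep_accepts[of clopen_rep, OF Fn b] accepting_run_iff_accepts[OF e] q[OF T] by simp
  qed (rule that; (assumption | simp))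
  have "computable_point u"
  proof (rule comp)
    show "computable \<mu>" unfolding \<mu>_def by (intro computable_intros)
    show "computable (\<lambda>z. T (ext (fst z)) (snd z))"
      unfolding T_def mem_def wit_def by (intro computable_intros)
    show "computable (\<lambda>z. accepting_run e (q (ext (fst z))) (ext (fst (snd z))) (snd (snd z)))"
      unfolding q_def mem_def join_def
      by (intro computable_intros)
  qed
  then obtain n where n: "U = f n" using computable_point_in_opens[OF u] onto by blast
  have "k \<in> A \<Longrightarrow> \<exists>x. \<not> (\<exists>y. recf_eval x d [k] y)" for k
    by (subst (asm) A) (rule CollectD)
  moreover have "k \<notin> A \<Longrightarrow> \<exists>x. \<not> (\<exists>y. recf_eval x d' [k] y)" for k
    by (subst (asm) Compl_iff[symmetric], subst (asm) A') (rule CollectD)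
  ultimately have "\<forall>k. \<exists>x. \<not> (\<exists>y. recf_eval x (if k \<in> A then d else d') [k] y)"
    by (simp del: not_ex)
  then obtain x where x: "\<And>k y. \<not> recf_eval (x k) (if k \<in> A then d else d') [k] y" by metis
  define p where "p = case_nat n (\<lambda>m. case prod_decode m of (k, j) \<Rightarrow>
    (case j of 0 \<Rightarrow> of_bool (k \<in> A) | Suc i \<Rightarrow> x k i))"
  have p: "p 0 = n" "mem p k \<longleftrightarrow> k \<in> A" "wit p k = x k" for k
    by (simp_all add: p_def mem_def wit_def fun_eq_iff)
  have "run s (x k) (if k \<in> A then d else d') [k] = 0" for s k
    using x run_sound by (metis not0_implies_Suc)
  then have "T p s" for s
    unfolding T_def p by (metis (full_types))
  then show False using diag[of p] zero n p(1) by simp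
qed

theorem theorem5p2:
  shows "\<not> baire_based (fun_rep rep_baire rep_two)
    \<and> \<not> computable_opens_Sigma11_enumerable (fun_rep rep_baire rep_two)
    \<and> (\<forall>A. Delta11 A \<longrightarrow> \<not> computable_opens_enumerable_rel A (fun_rep rep_baire rep_two))"
  using not_baire_based not_Sigma11_enumerable not_enumerable_rel_Delta11 by blast

end
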